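(* Let $X(t)$ be homogeneous, i.e. $\lambda(t)=\lambda\ge 0$ and $\mu(t)=\mu$ are constant, with $\mu>0$, and assume that there exist $0<q<1$ and $C>0$ such that $b_k\le Cq^k$ for all $k\ge1$. Then $X(t)$ is strongly ergodic, and the following bounds hold for every $\delta\in(q,1)$ and every $t\ge0$. (i) For any initial condition $\mathbf w(0)\in l_1$, the solution of $\frac{d}{dt}\mathbf w(t)=B^{**}(t)\mathbf w(t)$ satisfies $\|\mathbf w(t)\|\le e^{-(1-\delta)\mu t}\|\mathbf w(0)\|$. (ii) For any two solutions $\mathbf p^*(t),\mathbf p^{**}(t)$ of the forward Kolmogorov system whose initial conditions are probability vectors, with $\mathbf w(0)=DT(\mathbf z^*(0)-\mathbf z^{**}(0))$, $$\|\mathbf p^*(t)-\mathbf p^{**}(t)\|\le 4\,e^{-(1-\delta)\mu t}\|\mathbf w(0)\|.$$ (iii) $X(t)$ has a limiting mean $\phi(t)$ such that for every $k\in\mathcal X$ $$|E(t,k)-\phi(t)|\le\frac4W\,e^{-(1-\delta)\mu t}\|\mathbf w(0)\|,$$ where $W=\inf_{k\ge1}\frac{d_k}{k}>0$, $E(t,k)=\sum_{n\in\mathcal X}n\,p_n(t)$ is the mean number of customers at time $t$ given $p_k(0)=1$, and $\mathbf w(0)=DT(\mathbf z^*(0)-\mathbf z^{**}(0))$ is formed with $\mathbf p^*(0)$ the unit mass at $k$ and $\mathbf p^{**}(0)$ an initial probability vector (independent of $k$ and $\delta$, with $\|\mathbf w(0)\|<\infty$) of a solution $\mathbf p^{**}(t)$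 whose mean $\sum_{n\in\mathcal X}n\,p^{**}_n(t)$ is $\phi(t)$.
   Context: Queue model. Let $\{b_n,\ n\ge1\}$ be a probability distribution on $\{1,2,\dots\}$ (batch sizes) with finite mean, and put $B_k=\sum_{n\ge k}b_n$ (so $B_1=1$). Customers arrive in batches according to a Poisson process of intensity $\lambda(t)$; batch sizes are distributed as $\{b_n\}$. A batch whose size is strictly larger than the current number of customers replaces all the customers in the system; otherwise it is lost. Customers are served one by one with intensity $\mu(t)$. $X(t)$ is the number of customers at time $t$: it is a continuous-time Markov chain on $\mathcal X=\{0,1,\dots,b^*\}$, where $b^*=\max\{n: b_n>0\}$ (with $\mathcal X=\{0,1,2,\dots\}$ if the batch size has infinite support). Its transition intensities $q_{ij}(t)$ are: $q_{ij}(t)=\lambda(t)b_j$ for $j>i$; $q_{i,i-1}(t)=\mu(t)$ for $i\ge1$; $q_{00}(t)=-\lambda(t)$; $q_{ii}(t)=-(\mu(t)+\lambda(t)B_{i+1})$ for $i\ge1$; all others $0$. If $b^*<\infty$, all vectors and matrices below are truncated to the index set of $\mathcal X$ (or $\mathcal X\setminus\{0\}$). Let $Q(t)=(q_{ij}(t))$ and $A(t)=Q(t)^T$. The probability vector $\mathbf p(t)=(p_0(t),p_1(t),\dots)^T$, $p_i(t)=\mathbf P(X(t)=i)$, satisfies the forward Kolmogorov system $\frac{d}{dt}\mathbf p(t)=A(t)\mathbf p(t)$, understood for $l_1$-valued solutions. $\|\cdot\|$ is the $l_1$-norm. For a solution $\mathbf p^*$ (resp. $\mathbf p^{**}$), $\mathbf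 z^*$ (resp. $\mathbf z^{**}$) is the vector obtained by deleting the coordinate with index $0$. Let $T$ be the upper triangular matrix, indexed by $i,j\ge1$, with all entries on and above the diagonal equal to $1$. For $\delta\in(0,1)$ let $D=\mathrm{diag}(d_1,d_2,\dots)$ with $d_1=1$, $d_{k+1}=\delta^{-k}$, $k\ge1$. Let $B^*(t)$ be the matrix indexed by $i,j\ge1$ with diagonal entries $-(\mu(t)+\lambda(t)B_i)$, entries $\mu(t)$ at positions $(i,i+1)$, and all other entries $0$; put $B^{**}(t)=DB^*(t)D^{-1}$. For two solutions put $\mathbf w(t)=DT(\mathbf z^*(t)-\mathbf z^{**}(t))$; it satisfies $\frac{d}{dt}\mathbf w(t)=B^{**}(t)\mathbf w(t)$ whenever $\mathbf w(0)\in l_1$. A bound whose right-hand side is $+\infty$ is regarded as vacuous. Strong ergodicity: there is a probability vector $\boldsymbol\pi$ such that $\|\mathbf p(t)-\boldsymbol\pi\|\to0$ as $t\to\infty$ for every initial probability vector $\mathbf p(0)$. Limiting mean: a function $\phi(t)$ is a limiting mean of $X(t)$ if $E(t,k)-\phi(t)\to0$ as $t\to\infty$ for every $k\in\mathcal X$. *)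

theory Defs
  imports "HOL-Probability.Probability"
begin

text \<open>
  Vectors and matrices are total functions on the naturals, read only on an index set \<open>I\<close>;
  their values outside \<open>I\<close> are irrelevant. Truncation is a change of \<open>I\<close>.
\<close>

definition l1 :: "nat set \<Rightarrow> (nat \<Rightarrow> real) set" where
  "l1 I = {x. (\<lambda>i. \<bar>x i\<bar>) summable_on I}"

definition l1_norm :: "nat set \<Rightarrow> (nat \<Rightarrow> real) \<Rightarrow> real" where
  "l1_norm I x = (\<Sum>\<^sub>\<infinity>i\<in>I. \<bar>x i\<bar>)"

definition mat_vec :: "nat set \<Rightarrow> (nat \<Rightarrow> nat \<Rightarrow> real) \<Rightarrow> (nat \<Rightarrow> real) \<Rightarrow> nat \<Rightarrow> real" where
  "mat_vec I M x i = (\<Sum>\<^sub>\<infinity>j\<in>I. M i j * x j)"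

definition mat_mul ::
  "nat set \<Rightarrow> (nat \<Rightarrow> nat \<Rightarrow> real) \<Rightarrow> (nat \<Rightarrow> nat \<Rightarrow> real) \<Rightarrow> nat \<Rightarrow> nat \<Rightarrow> real" where
  "mat_mul I M N i j = (\<Sum>\<^sub>\<infinity>k\<in>I. M i k * N k j)"

definition diag_mat :: "(nat \<Rightarrow> real) \<Rightarrow> nat \<Rightarrow> nat \<Rightarrow> real" where
  "diag_mat d i j = (if i = j then d i else 0)"

definition prob_vector :: "nat set \<Rightarrow> (nat \<Rightarrow> real) \<Rightarrow> bool" where
  "prob_vector I x \<longleftrightarrow> (\<forall>i\<in>I. 0 \<le> x i) \<and> (x has_sum 1) I"

definition unit_mass :: "nat \<Rightarrow> nat \<Rightarrow> real" where
  "unit_mass k i = (if i = k then 1 else 0)"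

text \<open>
  Solutions on \<open>[0, \<infinity>)\<close> of the linear equation \<open>x' = M x\<close> in the Banach space of
  absolutely summable vectors: the difference quotients (one-sided at \<open>0\<close>) converge in the
  \<open>l1\<close>-norm, not merely coordinatewise.
\<close>

definition l1_solution ::
  "nat set \<Rightarrow> (nat \<Rightarrow> nat \<Rightarrow> real) \<Rightarrow> (real \<Rightarrow> nat \<Rightarrow> real) \<Rightarrow> bool" where
  "l1_solution I M x \<longleftrightarrow>
     (\<forall>t\<ge>0. x t \<in> l1 I \<and> mat_vec I M (x t) \<in> l1 I \<and>
        ((\<lambda>s. l1_norm I (\<lambda>i. (x s i - x t i) / (s - t) - mat_vec I M (x t) i)) \<longlongrightarrow> 0)
          (at t within {0..}))"

text \<open>
  ``The solution started at \<open>x0\<close> has property \<open>P\<close>''. Existence is part of the claim, so it can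
  never hold vacuously; \<open>P\<close> is required of every solution with this initial value.
\<close>

definition solution_satisfies ::
  "nat set \<Rightarrow> (nat \<Rightarrow> nat \<Rightarrow> real) \<Rightarrow> (nat \<Rightarrow> real) \<Rightarrow> ((real \<Rightarrow> nat \<Rightarrow> real) \<Rightarrow> bool) \<Rightarrow> bool" where
  "solution_satisfies I M x0 P \<longleftrightarrow>
     (\<exists>x. l1_solution I M x \<and> (\<forall>i\<in>I. x 0 i = x0 i)) \<and>
     (\<forall>x. l1_solution I M x \<and> (\<forall>i\<in>I. x 0 i = x0 i) \<longrightarrow> P x)"

definition batch_tail :: "nat pmf \<Rightarrow> nat \<Rightarrow> real" where
  "batch_tail b k = (\<Sum>\<^sub>\<infinity>n\<in>{k..}. pmf b n)"

definition state_space :: "nat pmf \<Rightarrow> nat set" where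
  "state_space b = (if finite (set_pmf b) then {0..Max (set_pmf b)} else UNIV)"

definition pos_states :: "nat pmf \<Rightarrow> nat set" where
  "pos_states b = state_space b - {0}"

definition intensity :: "nat pmf \<Rightarrow> real \<Rightarrow> real \<Rightarrow> nat \<Rightarrow> nat \<Rightarrow> real" where
  "intensity b lam mu i j =
     (if i < j then lam * pmf b j
      else if i = j + 1 then mu
      else if i = j then (if i = 0 then - lam else - (mu + lam * batch_tail b (i + 1)))
      else 0)"

definition kolmogorov_mat :: "nat pmf \<Rightarrow> real \<Rightarrow> real \<Rightarrow> nat \<Rightarrow> nat \<Rightarrow> real" where
  "kolmogorov_mat b lam mu i j = intensity b lam mu j i"

definition kolmogorov_solution :: "nat pmf \<Rightarrow> real \<Rightarrow> real \<Rightarrow> (real \<Rightarrow> nat \<Rightarrow> real) \<Rightarrow> bool" where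
  "kolmogorov_solution b lam mu p \<longleftrightarrow> l1_solution (state_space b) (kolmogorov_mat b lam mu) p"

definition strongly_ergodic :: "nat pmf \<Rightarrow> real \<Rightarrow> real \<Rightarrow> bool" where
  "strongly_ergodic b lam mu \<longleftrightarrow>
     (\<exists>\<pi>. prob_vector (state_space b) \<pi> \<and>
        (\<forall>p0. prob_vector (state_space b) p0 \<longrightarrow>
           solution_satisfies (state_space b) (kolmogorov_mat b lam mu) p0
             (\<lambda>p. ((\<lambda>t. l1_norm (state_space b) (\<lambda>i. p t i - \<pi> i)) \<longlongrightarrow> 0) at_top)))"

definition mean :: "nat pmf \<Rightarrow> (nat \<Rightarrow> real) \<Rightarrow> real" where
  "mean b x = (\<Sum>\<^sub>\<infinity>n\<in>state_space b. real n * x n)"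

definition has_finite_mean :: "nat pmf \<Rightarrow> (nat \<Rightarrow> real) \<Rightarrow> bool" where
  "has_finite_mean b x \<longleftrightarrow> (\<lambda>n. real n * x n) summable_on state_space b"

text \<open>
  The mean number of customers given \<open>k\<close> customers at time \<open>0\<close> is \<open>mean b (p t)\<close> for the
  solution \<open>p\<close> started at the unit mass at \<open>k\<close>.
\<close>

definition limiting_mean :: "nat pmf \<Rightarrow> real \<Rightarrow> real \<Rightarrow> (real \<Rightarrow> real) \<Rightarrow> bool" where
  "limiting_mean b lam mu \<phi> \<longleftrightarrow>
     (\<forall>k\<in>state_space b.
        solution_satisfies (state_space b) (kolmogorov_mat b lam mu) (unit_mass k)
          (\<lambda>p. (\<forall>t\<ge>0. has_finite_mean b (p t)) \<and>
               ((\<lambda>t. mean b (p t) - \<phi> t) \<longlongrightarrow> 0) at_top))"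

text \<open>Only indices \<open>k \<ge> 1\<close> are used: \<open>weight \<delta> 1 = 1\<close> and \<open>weight \<delta> (k + 1) = \<delta>\<^sup>-\<^sup>k\<close>.\<close>

definition weight :: "real \<Rightarrow> nat \<Rightarrow> real" where
  "weight \<delta> k = (1 / \<delta>) ^ (k - 1)"

definition D_mat :: "real \<Rightarrow> nat \<Rightarrow> nat \<Rightarrow> real" where
  "D_mat \<delta> = diag_mat (weight \<delta>)"

definition D_inv_mat :: "real \<Rightarrow> nat \<Rightarrow> nat \<Rightarrow> real" where
  "D_inv_mat \<delta> = diag_mat (\<lambda>k. 1 / weight \<delta> k)"

definition T_mat :: "nat \<Rightarrow> nat \<Rightarrow> real" where
  "T_mat i j = (if i \<le> j then 1 else 0)"

definition B_star :: "nat pmf \<Rightarrow> real \<Rightarrow> real \<Rightarrow> nat \<Rightarrow> nat \<Rightarrow> real" where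
  "B_star b lam mu i j =
     (if j = i then - (mu + lam * batch_tail b i) else if j = i + 1 then mu else 0)"

definition B_star2 :: "nat pmf \<Rightarrow> real \<Rightarrow> real \<Rightarrow> real \<Rightarrow> nat \<Rightarrow> nat \<Rightarrow> real" where
  "B_star2 b lam mu \<delta> =
     mat_mul (pos_states b) (mat_mul (pos_states b) (D_mat \<delta>) (B_star b lam mu)) (D_inv_mat \<delta>)"

text \<open>
  Reading a vector over \<open>pos_states b\<close> instead of \<open>state_space b\<close> deletes its coordinate \<open>0\<close>.
\<close>

definition w_vec :: "nat pmf \<Rightarrow> real \<Rightarrow> (nat \<Rightarrow> real) \<Rightarrow> (nat \<Rightarrow> real) \<Rightarrow> nat \<Rightarrow> real" where
  "w_vec b \<delta> p p' =
     mat_vec (pos_states b) (D_mat \<delta>) (mat_vec (pos_states b) T_mat (\<lambda>i. p i - p' i))"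

definition W_const :: "real \<Rightarrow> real" where
  "W_const \<delta> = (INF k\<in>{1..}. weight \<delta> k / real k)"

end

theory Submission
  imports Defs
begin

text \<open>
  The Kolmogorov matrix is a bounded operator on \<open>l1\<close>, so solutions exist by the exponential series,
  and an Euler-step estimate bounds every solution by the logarithmic norm of the matrix; this gives
  uniqueness, the \<open>l1\<close>-contraction for the Kolmogorov system and, since the column sums of
  \<open>B\<^sup>*\<^sup>*\<close> are at most \<open>-(1 - \<delta>) \<mu>\<close>, the decay of \<open>w\<close>. A bounded left inverse of
  \<open>z \<mapsto> D T z\<close> (of \<open>l1\<close>-norm at most 2, and at most \<open>2 / W\<close> after weighting by the state) intertwines
  \<open>B\<^sup>*\<^sup>*\<close> with the Kolmogorov matrix, so by uniqueness the difference of two solutions is the image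
  of \<open>w\<close>, and all decay estimates transfer. Stationary probabilities are explicit products with
  geometrically small tails; the stationary solution serves as \<open>p\<^sup>*\<^sup>*\<close>, with constant mean \<open>\<phi>\<close>.
\<close>

section \<open>Absolutely summable vectors\<close>

text \<open>Tail sums close up because a batch of size at least \<open>i\<close> replaces every
  population below \<open>i\<close>: from all those states the level \<open>i\<close> is reached at
  the same rate \<open>lam * batch_tail b i\<close>. So \<open>P(X \<ge> i)\<close> is coupled only
  to \<open>P(X \<ge> i + 1)\<close>, and the inhomogeneous term \<open>lam * batch_tail b i\<close>
  cancels in differences of solutions. The obstacle is that on infinitely many states
  \<open>D T\<close> is unbounded on \<open>l1\<close>: that \<open>z\<close> is differentiable in
  norm says nothing about \<open>D T z\<close>, which is not even known to stay in
  \<open>l1\<close>. Hence nothing is derived for \<open>D T z\<close> directly; \<open>w\<close> is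
  solved for from its initial value and mapped back to the original coordinates. Column
  \<open>j\<close> of the left inverse holds \<open>1 / weight \<delta> j\<close> in row
  \<open>j\<close> and its negative in row \<open>j - 1\<close>, which gives the constants 2 and
  \<open>2 / W\<close>; the constant 4 of the statement leaves room. Geometric batch tails pass to
  the stationary tails with the same rate \<open>q\<close>. Weighting them by powers of
  \<open>1 / \<delta>\<close> leaves a series of ratio \<open>q / \<delta>\<close>, whence the
  condition \<open>q < \<delta>\<close>.\<close>

lemma l1_iff: "x \<in> l1 I \<longleftrightarrow> x summable_on I"
  using summable_on_iff_abs_summable_on_real[of x I] by (simp add: l1_def)

lemma l1_norm_nonneg: "0 \<le> l1_norm I x"
  unfolding l1_norm_def by (rule infsum_nonneg) simp

lemma l1_cong: "(\<And>i. i \<in> I \<Longrightarrow> x i = y i) \<Longrightarrow> x \<in> l1 I \<longleftrightarrow> y \<in> l1 I"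
  unfolding l1_iff by (rule summable_on_cong)

lemma l1_norm_cong: "(\<And>i. i \<in> I \<Longrightarrow> x i = y i) \<Longrightarrow> l1_norm I x = l1_norm I y"
  unfolding l1_norm_def by (rule infsum_cong) simp

lemma mat_vec_cong: "(\<And>j. j \<in> I \<Longrightarrow> x j = y j) \<Longrightarrow> mat_vec I M x = mat_vec I M y"
  unfolding mat_vec_def by (intro ext infsum_cong) simp

lemma l1_add: "x \<in> l1 I \<Longrightarrow> y \<in> l1 I \<Longrightarrow> (\<lambda>i. x i + y i) \<in> l1 I"
  unfolding l1_iff by (rule summable_on_add)

lemma l1_scale: "x \<in> l1 I \<Longrightarrow> (\<lambda>i. c * x i) \<in> l1 I"
  unfolding l1_iff by (rule summable_on_cmult_right)

lemma l1_diff: "x \<in> l1 I \<Longrightarrow> y \<in> l1 I \<Longrightarrow> (\<lambda>i. x i - y i) \<in> l1 I"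
  using l1_add[OF _ l1_scale[of y I "-1"]] by simp

lemma l1_norm_scale: "l1_norm I (\<lambda>i. c * x i) = \<bar>c\<bar> * l1_norm I x"
  unfolding l1_norm_def by (simp add: abs_mult infsum_cmult_right')

lemma l1_norm_minus: "l1_norm I (\<lambda>i. y i - x i) = l1_norm I (\<lambda>i. x i - y i)"
  by (simp add: l1_norm_def abs_minus_commute)

lemma l1_norm_mono:
  assumes "y \<in> l1 I" "\<And>i. i \<in> I \<Longrightarrow> \<bar>x i\<bar> \<le> \<bar>y i\<bar>"
  shows "x \<in> l1 I" "l1_norm I x \<le> l1_norm I y"
proof -
  have y: "(\<lambda>i. \<bar>y i\<bar>) summable_on I" using assms(1) by (simp add: l1_def)
  show x: "x \<in> l1 I"
    unfolding l1_def using summable_on_comparison_test[OF y, of "\<lambda>i. \<bar>x i\<bar>"] assms(2) by simp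
  show "l1_norm I x \<le> l1_norm I y"
    unfolding l1_norm_def using x assms by (intro infsum_mono) (auto simp: l1_def)
qed

lemma l1_norm_triangle:
  assumes "x \<in> l1 I" "y \<in> l1 I"
  shows "l1_norm I (\<lambda>i. x i + y i) \<le> l1_norm I x + l1_norm I y"
proof -
  have s: "(\<lambda>i. \<bar>x i\<bar>) summable_on I" "(\<lambda>i. \<bar>y i\<bar>) summable_on I"
    using assms by (auto simp: l1_def)
  have "l1_norm I (\<lambda>i. x i + y i) \<le> (\<Sum>\<^sub>\<infinity>i\<in>I. \<bar>x i\<bar> + \<bar>y i\<bar>)"
    unfolding l1_norm_def using l1_add[OF assms] summable_on_add[OF s]
    by (intro infsum_mono) (auto simp: l1_def)
  then show ?thesis unfolding l1_norm_def by (simp add: infsum_add[OF s])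
qed

lemma l1_norm_triangle_diff:
  assumes "x \<in> l1 I" "y \<in> l1 I"
  shows "l1_norm I (\<lambda>i. x i - y i) \<le> l1_norm I x + l1_norm I y"
  using l1_norm_triangle[OF assms(1) l1_scale[OF assms(2), of "-1"]] l1_norm_scale[of I "-1" y]
  by simp

lemma l1_coord_le_norm:
  assumes "x \<in> l1 I" "i \<in> I" shows "\<bar>x i\<bar> \<le> l1_norm I x"
  using finite_sum_le_infsum[of "\<lambda>i. \<bar>x i\<bar>" I "{i}"] assms by (simp add: l1_def l1_norm_def)

lemma l1_norm_eq_0D:
  assumes "x \<in> l1 I" "l1_norm I x \<le> 0" "i \<in> I" shows "x i = 0"
  using l1_coord_le_norm[OF assms(1,3)] assms(2) by simp

text \<open>The family is absolutely summable on \<open>J \<times> I\<close> by the Sigma criterion;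
  reading the product in the other order gives the coordinatewise claims and the norm bound.
  Matrix-vector products (sums of scaled columns) and the exponential series are both such
  families.\<close>

lemma l1_infsum:
  fixes f :: "'k \<Rightarrow> nat \<Rightarrow> real"
  assumes f: "\<And>k. k \<in> J \<Longrightarrow> f k \<in> l1 I" and n: "(\<lambda>k. l1_norm I (f k)) summable_on J"
  shows l1_infsum_product: "(\<lambda>(k, i). f k i) summable_on J \<times> I"
    and l1_infsum_coord: "i \<in> I \<Longrightarrow> (\<lambda>k. f k i) summable_on J"
    and l1_infsum_mem: "(\<lambda>i. \<Sum>\<^sub>\<infinity>k\<in>J. f k i) \<in> l1 I"
    and l1_infsum_norm: "l1_norm I (\<lambda>i. \<Sum>\<^sub>\<infinity>k\<in>J. f k i) \<le> (\<Sum>\<^sub>\<infinity>k\<in>J. l1_norm I (f k))"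
proof -
  let ?F = "\<lambda>(k, i). f k i"
  have "(\<lambda>z. norm (?F z)) summable_on J \<times> I"
    unfolding Infinite_Sum.abs_summable_on_Sigma_iff using f n by (simp add: l1_def l1_norm_def[symmetric] l1_norm_nonneg)
  then have abs: "(\<lambda>(k, i). \<bar>f k i\<bar>) summable_on J \<times> I"
    by (simp add: case_prod_unfold)
  then show prod: "?F summable_on J \<times> I"
    using summable_on_iff_abs_summable_on_real[of ?F "J \<times> I"] by (simp add: case_prod_unfold)
  have "(\<lambda>(i, k). \<bar>f k i\<bar>) summable_on I \<times> J"
    using abs summable_on_swap[of "\<lambda>(k, i). \<bar>f k i\<bar>" J I] by (simp add: case_prod_unfold)
  then have "(\<lambda>z. norm ((\<lambda>(i, k). f k i) z)) summable_on I \<times> J"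
    by (simp add: case_prod_unfold)
  then have sw: "\<forall>i\<in>I. (\<lambda>k. \<bar>f k i\<bar>) summable_on J" "(\<lambda>i. \<Sum>\<^sub>\<infinity>k\<in>J. \<bar>f k i\<bar>) summable_on I"
    unfolding Infinite_Sum.abs_summable_on_Sigma_iff
    using summable_on_iff_abs_summable_on_real[of "\<lambda>i. \<Sum>\<^sub>\<infinity>k\<in>J. \<bar>f k i\<bar>" I] by auto
  show "i \<in> I \<Longrightarrow> (\<lambda>k. f k i) summable_on J" for i
    using sw(1) summable_on_iff_abs_summable_on_real[of "\<lambda>k. f k i" J] by simp
  have le: "\<bar>\<Sum>\<^sub>\<infinity>k\<in>J. f k i\<bar> \<le> (\<Sum>\<^sub>\<infinity>k\<in>J. \<bar>f k i\<bar>)" if "i \<in> I" for i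
    using norm_infsum_bound[of "\<lambda>k. f k i" J] sw(1) that by simp
  then show mem: "(\<lambda>i. \<Sum>\<^sub>\<infinity>k\<in>J. f k i) \<in> l1 I"
    unfolding l1_def using summable_on_comparison_test[OF sw(2)] by force
  have "l1_norm I (\<lambda>i. \<Sum>\<^sub>\<infinity>k\<in>J. f k i) \<le> (\<Sum>\<^sub>\<infinity>i\<in>I. \<Sum>\<^sub>\<infinity>k\<in>J. \<bar>f k i\<bar>)"
    unfolding l1_norm_def using mem sw(2) le by (intro infsum_mono) (auto simp: l1_def)
  also have "\<dots> = (\<Sum>\<^sub>\<infinity>k\<in>J. l1_norm I (f k))"
    unfolding l1_norm_def by (rule infsum_swap_banach[OF abs, symmetric])
  finally show "l1_norm I (\<lambda>i. \<Sum>\<^sub>\<infinity>k\<in>J. f k i) \<le> (\<Sum>\<^sub>\<infinity>k\<in>J. l1_norm I (f k))" .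
qed

section \<open>Matrices with uniformly bounded column sums, as bounded operators from
  \<open>l1 J\<close> to \<open>l1 I\<close>\<close>

definition cols_bounded :: "nat set \<Rightarrow> nat set \<Rightarrow> (nat \<Rightarrow> nat \<Rightarrow> real) \<Rightarrow> real \<Rightarrow> bool" where
  "cols_bounded I J M K \<longleftrightarrow>
     0 \<le> K \<and> (\<forall>j\<in>J. (\<lambda>i. M i j) \<in> l1 I \<and> l1_norm I (\<lambda>i. M i j) \<le> K)"

lemma cols_bounded_family:
  assumes M: "cols_bounded I J M K" and x: "x \<in> l1 J"
  shows "\<And>j. j \<in> J \<Longrightarrow> (\<lambda>i. M i j * x j) \<in> l1 I"
    and "(\<lambda>j. l1_norm I (\<lambda>i. M i j * x j)) summable_on J"
    and "(\<Sum>\<^sub>\<infinity>j\<in>J. l1_norm I (\<lambda>i. M i j * x j)) \<le> K * l1_norm J x"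
proof -
  show "(\<lambda>i. M i j * x j) \<in> l1 I" if "j \<in> J" for j
    using M that l1_scale[of "\<lambda>i. M i j" I "x j"] by (simp add: cols_bounded_def mult.commute)
  have n: "l1_norm I (\<lambda>i. M i j * x j) = \<bar>x j\<bar> * l1_norm I (\<lambda>i. M i j)" for j
    using l1_norm_scale[of I "x j" "\<lambda>i. M i j"] by (simp add: mult.commute)
  have le: "l1_norm I (\<lambda>i. M i j * x j) \<le> K * \<bar>x j\<bar>" if "j \<in> J" for j
    using M that unfolding n cols_bounded_def by (metis abs_ge_zero mult.commute mult_right_mono)
  have s: "(\<lambda>j. K * \<bar>x j\<bar>) summable_on J"
    using x by (simp add: l1_def summable_on_cmult_right)
  show t: "(\<lambda>j. l1_norm I (\<lambda>i. M i j * x j)) summable_on J"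
    by (rule summable_on_comparison_test[OF s]) (use le l1_norm_nonneg in auto)
  have "(\<Sum>\<^sub>\<infinity>j\<in>J. l1_norm I (\<lambda>i. M i j * x j)) \<le> (\<Sum>\<^sub>\<infinity>j\<in>J. K * \<bar>x j\<bar>)"
    by (rule infsum_mono[OF t s le])
  then show "(\<Sum>\<^sub>\<infinity>j\<in>J. l1_norm I (\<lambda>i. M i j * x j)) \<le> K * l1_norm J x"
    by (simp add: l1_norm_def infsum_cmult_right')
qed

lemma mat_vec_coord_summable:
  assumes "cols_bounded I J M K" "x \<in> l1 J" "i \<in> I"
  shows "(\<lambda>j. M i j * x j) summable_on J"
  using l1_infsum_coord[OF cols_bounded_family(1,2)[OF assms(1,2)] assms(3)] .

lemma mat_vec_l1:
  assumes "cols_bounded I J M K" "x \<in> l1 J"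
  shows "mat_vec J M x \<in> l1 I" "l1_norm I (mat_vec J M x) \<le> K * l1_norm J x"
  using l1_infsum_mem[OF cols_bounded_family(1,2)[OF assms]]
    l1_infsum_norm[OF cols_bounded_family(1,2)[OF assms]] cols_bounded_family(3)[OF assms]
  unfolding mat_vec_def[abs_def] by auto

lemma mat_vec_scale_row: "mat_vec X (\<lambda>i j. c i * M i j) x i = c i * mat_vec X M x i"
  unfolding mat_vec_def by (simp add: mult.assoc infsum_cmult_right')

lemma mat_vec_scale: "mat_vec J M (\<lambda>j. c * x j) i = c * mat_vec J M x i"
  unfolding mat_vec_def by (simp add: mult.left_commute infsum_cmult_right')

lemma mat_vec_add:
  assumes "cols_bounded I J M K" "x \<in> l1 J" "y \<in> l1 J" "i \<in> I"
  shows "mat_vec J M (\<lambda>j. x j + y j) i = mat_vec J M x i + mat_vec J M y i"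
  unfolding mat_vec_def using infsum_add[OF mat_vec_coord_summable[OF assms(1,2,4)]
      mat_vec_coord_summable[OF assms(1,3,4)]] by (simp add: distrib_left)

lemma mat_vec_diff:
  assumes "cols_bounded I J M K" "x \<in> l1 J" "y \<in> l1 J" "i \<in> I"
  shows "mat_vec J M (\<lambda>j. x j - y j) i = mat_vec J M x i - mat_vec J M y i"
  using mat_vec_add[OF assms(1,2) l1_scale[OF assms(3), of "-1"] assms(4)]
    mat_vec_scale[of J M "-1" y i] by simp

text \<open>A row is a bounded functional: each entry is a coordinate of a column, hence at most
  \<open>K\<close> in absolute value. This justifies exchanging the sums over \<open>j\<close> and
  \<open>k\<close>, and so applying a matrix termwise to the exponential series.\<close>

lemma mat_vec_infsum:
  fixes f :: "'k \<Rightarrow> nat \<Rightarrow> real"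
  assumes M: "cols_bounded I J M K" and i: "i \<in> I"
    and f: "\<And>k. k \<in> L \<Longrightarrow> f k \<in> l1 J" "(\<lambda>k. l1_norm J (f k)) summable_on L"
  shows "mat_vec J M (\<lambda>j. \<Sum>\<^sub>\<infinity>k\<in>L. f k j) i = (\<Sum>\<^sub>\<infinity>k\<in>L. mat_vec J M (f k) i)"
proof -
  have Mb: "\<bar>M i j\<bar> \<le> K" if "j \<in> J" for j
    using l1_coord_le_norm[of "\<lambda>i. M i j" I i] M i that by (force simp: cols_bounded_def)
  have le: "\<bar>M i j * x\<bar> \<le> \<bar>K * x\<bar>" if "j \<in> J" for j x
  proof -
    have "\<bar>M i j\<bar> * \<bar>x\<bar> \<le> \<bar>K\<bar> * \<bar>x\<bar>"
      using Mb[OF that] by (intro mult_right_mono) auto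
    then show ?thesis by (simp add: abs_mult)
  qed
  have mem: "(\<lambda>j. M i j * f k j) \<in> l1 J" if "k \<in> L" for k
    by (rule l1_norm_mono(1)[OF l1_scale[OF f(1)[OF that], of K]]) (rule le)
  have nle: "l1_norm J (\<lambda>j. M i j * f k j) \<le> \<bar>K\<bar> * l1_norm J (f k)" if "k \<in> L" for k
    using l1_norm_mono(2)[OF l1_scale[OF f(1)[OF that], of K], of "\<lambda>j. M i j * f k j"] le
    by (simp add: l1_norm_scale)
  have "(\<lambda>k. l1_norm J (\<lambda>j. M i j * f k j)) summable_on L"
    by (rule summable_on_comparison_test[OF summable_on_cmult_right[OF f(2), of "\<bar>K\<bar>"]])
       (use nle l1_norm_nonneg in auto)
  from infsum_swap_banach[OF l1_infsum_product[OF mem this]]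
  show ?thesis unfolding mat_vec_def by (simp add: infsum_cmult_right')
qed

section \<open>Linear equations in \<open>l1\<close>\<close>

lemma eventually_at_within_mem: "eventually (\<lambda>s. s \<in> S \<and> s \<noteq> t) (at t within S)"
  by (simp add: eventually_at_filter)

lemma l1_quotient:
  assumes "x \<in> l1 I" "y \<in> l1 I" "v \<in> l1 I"
  shows "(\<lambda>i. (x i - y i) / h - v i) \<in> l1 I"
  using l1_diff[OF l1_scale[OF l1_diff[OF assms(1,2)], of "1 / h"] assms(3)] by simp

lemma l1_solutionD:
  assumes "l1_solution I M x" "0 \<le> t"
  shows "x t \<in> l1 I" "mat_vec I M (x t) \<in> l1 I"
    "((\<lambda>s. l1_norm I (\<lambda>i. (x s i - x t i) / (s - t) - mat_vec I M (x t) i)) \<longlongrightarrow> 0) (at t within {0..})"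
  using assms unfolding l1_solution_def by auto

lemma l1_solution_const:
  assumes "x \<in> l1 I" "\<And>i. i \<in> I \<Longrightarrow> mat_vec I M x i = 0"
  shows "l1_solution I M (\<lambda>t. x)"
proof -
  have "l1_norm I (\<lambda>i. - mat_vec I M x i) = l1_norm I (\<lambda>i. 0)"
    using assms(2) by (intro l1_norm_cong) simp
  moreover have "mat_vec I M x \<in> l1 I \<longleftrightarrow> (\<lambda>i. 0) \<in> l1 I"
    using assms(2) by (intro l1_cong) simp
  ultimately show ?thesis using assms(1) unfolding l1_solution_def by (simp add: l1_norm_def l1_iff)
qed

lemma l1_solution_diff:
  assumes M: "cols_bounded I I M K" and x: "l1_solution I M x" and y: "l1_solution I M y"
  shows "l1_solution I M (\<lambda>t i. x t i - y t i)"
  unfolding l1_solution_def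
proof (intro allI impI conjI)
  fix t :: real assume t: "0 \<le> t"
  note X = l1_solutionD[OF x t] and Y = l1_solutionD[OF y t]
  show d: "(\<lambda>i. x t i - y t i) \<in> l1 I" by (rule l1_diff[OF X(1) Y(1)])
  show "mat_vec I M (\<lambda>i. x t i - y t i) \<in> l1 I" by (rule mat_vec_l1(1)[OF M d])
  let ?q = "\<lambda>x s i. (x s i - x t i) / (s - t) - mat_vec I M (x t) i"
  show "((\<lambda>s. l1_norm I (\<lambda>i. (x s i - y s i - (x t i - y t i)) / (s - t)
      - mat_vec I M (\<lambda>i. x t i - y t i) i)) \<longlongrightarrow> 0) (at t within {0..})"
  proof (rule tendsto_sandwich[OF _ _ tendsto_const])
    show "((\<lambda>s. l1_norm I (?q x s) + l1_norm I (?q y s)) \<longlongrightarrow> 0) (at t within {0..})"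
      using tendsto_add[OF X(3) Y(3)] by simp
    show "eventually (\<lambda>s. l1_norm I (\<lambda>i. (x s i - y s i - (x t i - y t i)) / (s - t)
      - mat_vec I M (\<lambda>i. x t i - y t i) i) \<le> l1_norm I (?q x s) + l1_norm I (?q y s)) (at t within {0..})"
      using eventually_at_within_mem[of "{0..}" t]
    proof eventually_elim
      case (elim s)
      then have s: "0 \<le> s" by simp
      have "l1_norm I (\<lambda>i. (x s i - y s i - (x t i - y t i)) / (s - t)
        - mat_vec I M (\<lambda>i. x t i - y t i) i) = l1_norm I (\<lambda>i. ?q x s i - ?q y s i)"
        by (rule l1_norm_cong) (simp add: mat_vec_diff[OF M X(1) Y(1)] diff_divide_distrib)
      also have "\<dots> \<le> l1_norm I (?q x s) + l1_norm I (?q y s)"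
        by (intro l1_norm_triangle_diff l1_quotient X Y l1_solutionD(1)[OF x s] l1_solutionD(1)[OF y s])
      finally show ?case .
    qed
  qed (simp add: l1_norm_nonneg)
qed

text \<open>A bounded operator commutes with difference quotients, so the error of the image is
  \<open>S\<close> applied to the error of \<open>w\<close>; the intertwining relation turns
  \<open>S M w\<close> into \<open>N S w\<close>.\<close>

lemma l1_solution_image:
  assumes M: "cols_bounded J J M K" and N: "cols_bounded I I N K'" and S: "cols_bounded I J S c"
    and w: "l1_solution J M w"
    and intertwine: "\<And>v i. v \<in> l1 J \<Longrightarrow> i \<in> I \<Longrightarrow>
      mat_vec I N (mat_vec J S v) i = mat_vec J S (mat_vec J M v) i"
  shows "l1_solution I N (\<lambda>t. mat_vec J S (w t))"
  unfolding l1_solution_def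
proof (intro allI impI conjI)
  fix t :: real assume t: "0 \<le> t"
  note W = l1_solutionD[OF w t]
  show d: "mat_vec J S (w t) \<in> l1 I" by (rule mat_vec_l1(1)[OF S W(1)])
  show "mat_vec I N (mat_vec J S (w t)) \<in> l1 I" by (rule mat_vec_l1(1)[OF N d])
  let ?q = "\<lambda>s j. (w s j - w t j) / (s - t) - mat_vec J M (w t) j"
  show "((\<lambda>s. l1_norm I (\<lambda>i. (mat_vec J S (w s) i - mat_vec J S (w t) i) / (s - t)
      - mat_vec I N (mat_vec J S (w t)) i)) \<longlongrightarrow> 0) (at t within {0..})"
  proof (rule tendsto_sandwich[OF _ _ tendsto_const])
    show "((\<lambda>s. c * l1_norm J (?q s)) \<longlongrightarrow> 0) (at t within {0..})"
      using tendsto_mult_right_zero[OF W(3)] by simp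
    show "eventually (\<lambda>s. l1_norm I (\<lambda>i. (mat_vec J S (w s) i - mat_vec J S (w t) i) / (s - t)
      - mat_vec I N (mat_vec J S (w t)) i) \<le> c * l1_norm J (?q s)) (at t within {0..})"
      using eventually_at_within_mem[of "{0..}" t]
    proof eventually_elim
      case (elim s)
      then have s: "w s \<in> l1 J" using l1_solutionD(1)[OF w] by simp
      have dq: "(\<lambda>j. (w s j - w t j) / (s - t)) \<in> l1 J"
        using l1_scale[OF l1_diff[OF s W(1)], of "1 / (s - t)"] by simp
      have "mat_vec J S (?q s) i = (mat_vec J S (w s) i - mat_vec J S (w t) i) / (s - t)
        - mat_vec I N (mat_vec J S (w t)) i" if i: "i \<in> I" for i
        using mat_vec_diff[OF S dq W(2) i] mat_vec_diff[OF S s W(1) i]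
          mat_vec_scale[of J S "1 / (s - t)" "\<lambda>j. w s j - w t j" i] intertwine[OF W(1) i] by simp
      then have "l1_norm I (\<lambda>i. (mat_vec J S (w s) i - mat_vec J S (w t) i) / (s - t)
        - mat_vec I N (mat_vec J S (w t)) i) = l1_norm I (mat_vec J S (?q s))"
        by (intro l1_norm_cong) simp
      also have "\<dots> \<le> c * l1_norm J (?q s)"
        by (intro mat_vec_l1(2)[OF S] l1_quotient s W)
      finally show ?case .
    qed
  qed (simp add: l1_norm_nonneg)
qed

section \<open>Growth of solutions and uniqueness\<close>

text \<open>Replaces a derivative test: the norm of a solution need not be differentiable, and Euler
  steps control it only to the right. The times up to \<open>T\<close> with
  \<open>f t \<le> f 0\<close> form a closed set, and a supremum below \<open>T\<close> could be
  exceeded by one more step.\<close>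

lemma decreasing_if_locally_right_decreasing:
  fixes f :: "real \<Rightarrow> real"
  assumes cont: "continuous_on {0..} f"
    and step: "\<And>t. 0 \<le> t \<Longrightarrow> eventually (\<lambda>s. f s \<le> f t) (at_right t)"
    and T: "0 \<le> T"
  shows "f T \<le> f 0"
proof -
  define S where "S = {t\<in>{0..T}. f t \<le> f 0}"
  have "closed ({0..T} \<inter> f -` {..f 0})"
    using continuous_on_subset[OF cont] by (intro continuous_closed_preimage) auto
  moreover have "{0..T} \<inter> f -` {..f 0} = S" by (auto simp: S_def)
  ultimately have cl: "closed S" by simp
  have bdd: "bdd_above S" by (auto simp: S_def bdd_above_def)
  have "0 \<in> S" using T by (simp add: S_def)
  define c where "c = Sup S"
  have c: "c \<in> S" unfolding c_def using closed_contains_Sup[OF _ bdd cl] \<open>0 \<in> S\<close> by auto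
  have "c = T"
  proof (rule ccontr)
    assume "c \<noteq> T"
    with c have cT: "c < T" and c0: "0 \<le> c" by (auto simp: S_def)
    have "eventually (\<lambda>s. s \<in> {c<..T} \<and> f s \<le> f c) (at_right c)"
      using step[OF c0] eventually_at_right_less[of c] eventually_at_right_real[OF cT]
      by eventually_elim auto
    then obtain s where s: "c < s" "s \<le> T" "f s \<le> f c"
      using eventually_happens[of _ "at_right c"] trivial_limit_at_right_real by auto
    then have "s \<in> S" using c by (auto simp: S_def)
    then have "s \<le> c" unfolding c_def by (rule cSup_upper[OF _ bdd])
    with s show False by simp
  qed
  with c show ?thesis by (simp add: S_def)
qed

lemma l1_solution_norm_continuous:
  assumes x: "l1_solution I M x"
  shows "continuous_on {0..} (\<lambda>t. l1_norm I (x t))"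
  unfolding continuous_on_def
proof
  fix t :: real assume "t \<in> {0..}"
  then have t: "0 \<le> t" by simp
  note X = l1_solutionD[OF x t]
  let ?q = "\<lambda>s i. (x s i - x t i) / (s - t) - mat_vec I M (x t) i"
  let ?b = "\<lambda>s. \<bar>s - t\<bar> * (l1_norm I (?q s) + l1_norm I (mat_vec I M (x t)))"
  have "((\<lambda>s. l1_norm I (x s) - l1_norm I (x t)) \<longlongrightarrow> 0) (at t within {0..})"
  proof (rule Lim_null_comparison)
    have "((\<lambda>s. \<bar>s - t\<bar>) \<longlongrightarrow> 0) (at t within {0..})"
      by (rule tendsto_eq_intros refl | simp)+
    from tendsto_mult[OF this tendsto_add[OF X(3) tendsto_const]]
    show "(?b \<longlongrightarrow> 0) (at t within {0..})" by simp
    show "eventually (\<lambda>s. norm (l1_norm I (x s) - l1_norm I (x t)) \<le> ?b s) (at t within {0..})"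
      using eventually_at_within_mem[of "{0..}" t]
    proof eventually_elim
      case (elim s)
      then have s: "x s \<in> l1 I" and st: "s \<noteq> t" using l1_solutionD(1)[OF x] by auto
      have q: "?q s \<in> l1 I" by (intro l1_quotient s X)
      have "l1_norm I (\<lambda>i. x s i - x t i) = l1_norm I (\<lambda>i. (s - t) * (?q s i + mat_vec I M (x t) i))"
        using st by (intro l1_norm_cong) simp
      also have "\<dots> \<le> ?b s"
        unfolding l1_norm_scale by (intro mult_left_mono l1_norm_triangle q X) simp
      finally have le: "l1_norm I (\<lambda>i. x s i - x t i) \<le> ?b s" .
      have "l1_norm I (x s) \<le> l1_norm I (\<lambda>i. x s i - x t i) + l1_norm I (x t)"
        using l1_norm_triangle[OF l1_diff[OF s X(1)] X(1)] by simp
      moreover have "l1_norm I (x t) \<le> l1_norm I (\<lambda>i. x s i - x t i) + l1_norm I (x s)"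
        using l1_norm_triangle[OF l1_diff[OF X(1) s] s] l1_norm_minus[of I "x s" "x t"] by simp
      ultimately show ?case using le by simp
    qed
  qed
  then show "((\<lambda>t. l1_norm I (x t)) \<longlongrightarrow> l1_norm I (x t)) (at t within {0..})"
    by (simp add: LIM_zero_iff)
qed

text \<open>The logarithmic norm (matrix measure) belonging to the \<open>l1\<close> norm. The
  diagonal entry keeps its sign, so the bound \<open>a\<close> can be negative and express
  decay.\<close>

definition log_norm_le :: "nat set \<Rightarrow> (nat \<Rightarrow> nat \<Rightarrow> real) \<Rightarrow> real \<Rightarrow> bool" where
  "log_norm_le I M a \<longleftrightarrow> (\<forall>j\<in>I. M j j + l1_norm (I - {j}) (\<lambda>i. M i j) \<le> a)"

lemma l1_norm_insert:
  assumes "j \<in> I" "x \<in> l1 I"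
  shows "l1_norm I x = \<bar>x j\<bar> + l1_norm (I - {j}) x"
  using infsum_insert[of "\<lambda>i. \<bar>x i\<bar>" "I - {j}" j] assms summable_on_subset_banach[of "\<lambda>i. \<bar>x i\<bar>" I "I - {j}"]
  by (simp add: l1_def l1_norm_def insert_absorb)

lemma l1_norm_euler_step:
  assumes M: "cols_bounded I I M K" and a: "log_norm_le I M a"
    and h: "0 \<le> h" "h * K \<le> 1" "0 \<le> 1 + h * a" and x: "x \<in> l1 I"
  shows "l1_norm I (\<lambda>i. x i + h * mat_vec I M x i) \<le> (1 + h * a) * l1_norm I x"
proof -
  define N where "N = (\<lambda>i j. (if i = j then 1 else 0) + h * M i j)"
  have one: "(\<lambda>i. if i = j then 1 else 0) \<in> l1 I" for j :: nat
    unfolding l1_iff by (rule finite_nonzero_values_imp_summable_on) simp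
  have Nmem: "(\<lambda>i. N i j) \<in> l1 I" if "j \<in> I" for j
    using M that one unfolding N_def cols_bounded_def by (intro l1_add l1_scale) auto
  have Nle: "l1_norm I (\<lambda>i. N i j) \<le> 1 + h * a" if j: "j \<in> I" for j
  proof -
    have "\<bar>M j j\<bar> \<le> K"
      using l1_coord_le_norm[of "\<lambda>i. M i j" I j] M j by (force simp: cols_bounded_def)
    then have "h * \<bar>M j j\<bar> \<le> h * K" using h(1) by (rule mult_left_mono)
    then have "\<bar>N j j\<bar> = 1 + h * M j j"
      using h abs_ge_minus_self[of "h * M j j"] by (simp add: N_def abs_mult)
    moreover have "l1_norm (I - {j}) (\<lambda>i. N i j) = h * l1_norm (I - {j}) (\<lambda>i. M i j)"
      using l1_norm_cong[of "I - {j}" "\<lambda>i. N i j" "\<lambda>i. h * M i j"] h(1)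
      by (simp add: N_def l1_norm_scale)
    ultimately have "l1_norm I (\<lambda>i. N i j) = 1 + h * (M j j + l1_norm (I - {j}) (\<lambda>i. M i j))"
      using l1_norm_insert[OF j Nmem[OF j]] by (simp add: distrib_left)
    also have "\<dots> \<le> 1 + h * a"
      using a j h(1) by (auto simp: log_norm_le_def intro!: mult_left_mono)
    finally show ?thesis .
  qed
  have "cols_bounded I I N (1 + h * a)"
    using Nmem Nle h(3) by (simp add: cols_bounded_def)
  moreover have "mat_vec I N x i = x i + h * mat_vec I M x i" if "i \<in> I" for i
  proof -
    have "((\<lambda>j. if i = j then x j else 0) has_sum x i) I"
      by (rule has_sum_finite_neutralI[of "{i}"]) (use that in auto)
    from has_sum_add[OF this has_sum_cmult_right[OF has_sum_infsum[OF mat_vec_coord_summable[OF M x that]], of h]]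
    have "((\<lambda>j. N i j * x j) has_sum (x i + h * mat_vec I M x i)) I"
      unfolding mat_vec_def by (rule has_sum_cong[THEN iffD1, rotated]) (simp add: N_def distrib_right)
    then show ?thesis unfolding mat_vec_def by (rule infsumI)
  qed
  then have "l1_norm I (\<lambda>i. x i + h * mat_vec I M x i) = l1_norm I (mat_vec I N x)"
    by (intro l1_norm_cong) simp
  ultimately show ?thesis using mat_vec_l1(2)[of I I N "1 + h * a" x] x by simp
qed

lemma difference_quotient_expand: "h \<noteq> 0 \<Longrightarrow> (b::real) = (a + h * m) + h * ((b - a) / h - m)"
  by (simp add: field_simps)

text \<open>A Gronwall argument with Euler steps: moving from \<open>t\<close> to a slightly larger
  \<open>s\<close> multiplies the norm by at most \<open>1 + (s - t) * a\<close>, which is at most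
  \<open>exp ((s - t) * a)\<close>, up to an error that is small compared with
  \<open>s - t\<close>.\<close>

lemma l1_solution_norm_le:
  assumes M: "cols_bounded I I M K" and a: "log_norm_le I M a"
    and x: "l1_solution I M x" and T: "0 \<le> T"
  shows "l1_norm I (x T) \<le> exp (a * T) * l1_norm I (x 0)"
proof -
  define u where "u = (\<lambda>t. l1_norm I (x t))"
  have u_step: "eventually (\<lambda>s. u s \<le> (1 + (s - t) * a) * u t + (s - t) * e) (at_right t)"
    if t: "0 \<le> t" and e: "0 < e" for t e
  proof -
    note X = l1_solutionD[OF x t]
    have sub: "{t<..} \<subseteq> {0..}" using t by auto
    have "eventually (\<lambda>s. l1_norm I (\<lambda>i. (x s i - x t i) / (s - t) - mat_vec I M (x t) i) < e) (at_right t)"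
      using order_tendstoD(2)[OF tendsto_within_subset[OF X(3) sub] e] .
    moreover have "((\<lambda>s. (s - t) * K) \<longlongrightarrow> 0) (at_right t)"
      by (rule tendsto_eq_intros refl | simp)+
    then have "eventually (\<lambda>s. (s - t) * K < 1) (at_right t)"
      by (rule order_tendstoD) simp
    moreover have "((\<lambda>s. 1 + (s - t) * a) \<longlongrightarrow> 1) (at_right t)"
      by (rule tendsto_eq_intros refl | simp)+
    then have "eventually (\<lambda>s. 0 < 1 + (s - t) * a) (at_right t)"
      by (rule order_tendstoD) simp
    ultimately show ?thesis using eventually_at_within_mem[of "{t<..}" t]
    proof eventually_elim
      case (elim s)
      let ?q = "\<lambda>i. (x s i - x t i) / (s - t) - mat_vec I M (x t) i"
      have s: "x s \<in> l1 I" using l1_solutionD(1)[OF x] elim t by simp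
      have "u s = l1_norm I (\<lambda>i. (x t i + (s - t) * mat_vec I M (x t) i) + (s - t) * ?q i)"
        unfolding u_def using elim by (intro l1_norm_cong difference_quotient_expand) simp
      also have "\<dots> \<le> l1_norm I (\<lambda>i. x t i + (s - t) * mat_vec I M (x t) i) + \<bar>s - t\<bar> * l1_norm I ?q"
        unfolding l1_norm_scale[symmetric]
        by (intro l1_norm_triangle l1_add l1_scale l1_quotient s X)
      also have "\<dots> \<le> (1 + (s - t) * a) * u t + (s - t) * e"
        unfolding u_def using elim by (intro add_mono l1_norm_euler_step[OF M a] X mult_mono l1_norm_nonneg) auto
      finally show ?case .
    qed
  qed
  have bound: "exp (- a * T) * u T \<le> u 0 + e * T" if e: "0 < e" for e
  proof -
    \<comment> \<open>The term \<open>- e * t\<close> is the slack that absorbs the Euler errors;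
      \<open>e\<close> is sent to 0 afterwards.\<close>
    define f where "f = (\<lambda>t. exp (- a * t) * u t - e * t)"
    have "f T \<le> f 0"
    proof (rule decreasing_if_locally_right_decreasing[OF _ _ T])
      show "continuous_on {0..} f"
        unfolding f_def u_def by (intro continuous_intros l1_solution_norm_continuous[OF x])
      fix t :: real assume t: "0 \<le> t"
      \<comment> \<open>The error allowed at \<open>t\<close> is \<open>e * exp (a * t) / 2\<close>:
        multiplied by \<open>exp (- a * s)\<close> it tends to \<open>e / 2\<close>, hence stays
        below \<open>e\<close> for \<open>s\<close> close to \<open>t\<close>.\<close>
      have "((\<lambda>s. exp (- a * s) * (e * exp (a * t) / 2)) \<longlongrightarrow> e / 2) (at_right t)"
        by (rule tendsto_eq_intros refl | simp add: exp_minus)+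
      then have "eventually (\<lambda>s. exp (- a * s) * (e * exp (a * t) / 2) < e) (at_right t)"
        by (rule order_tendstoD) (use e in simp)
      moreover have "eventually (\<lambda>s. u s \<le> (1 + (s - t) * a) * u t + (s - t) * (e * exp (a * t) / 2)) (at_right t)"
        by (rule u_step[OF t]) (use e in simp)
      ultimately show "eventually (\<lambda>s. f s \<le> f t) (at_right t)"
        using eventually_at_within_mem[of "{t<..}" t]
      proof eventually_elim
        case (elim s)
        have "exp (- a * s) * u s \<le> exp (- a * s) * ((1 + (s - t) * a) * u t + (s - t) * (e * exp (a * t) / 2))"
          using elim by (intro mult_left_mono) auto
        also have "\<dots> = exp (- a * s) * (1 + (s - t) * a) * u t + (s - t) * (exp (- a * s) * (e * exp (a * t) / 2))"
          by (simp add: algebra_simps)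
        also have "\<dots> \<le> exp (- a * t) * u t + (s - t) * e"
        proof (intro add_mono mult_right_mono mult_left_mono)
          have "exp (- a * s) * (1 + (s - t) * a) \<le> exp (- a * s) * exp ((s - t) * a)"
            using exp_ge_add_one_self[of "(s - t) * a"] by (intro mult_left_mono) auto
          also have "\<dots> = exp (- a * t)" by (simp add: exp_add[symmetric] algebra_simps)
          finally show "exp (- a * s) * (1 + (s - t) * a) \<le> exp (- a * t)" .
        qed (use elim l1_norm_nonneg in \<open>auto simp: u_def\<close>)
        finally show ?case by (simp add: f_def algebra_simps)
      qed
    qed
    then show ?thesis by (simp add: f_def)
  qed
  have "exp (- a * T) * u T \<le> u 0"
  proof (rule field_le_epsilon)
    fix e :: real assume e: "0 < e"
    \<comment> \<open>The divisor is \<open>T + 1\<close> because \<open>T\<close> may be 0.\<close>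
    have "e / (T + 1) * T \<le> e" using T e by (simp add: field_simps)
    then show "exp (- a * T) * u T \<le> u 0 + e"
      using bound[of "e / (T + 1)"] T e by simp
  qed
  then show ?thesis unfolding u_def by (simp add: exp_minus field_simps)
qed

text \<open>Crude, but sufficient for uniqueness, where the initial norm is 0.\<close>

lemma cols_bounded_log_norm:
  assumes "cols_bounded I I M K" shows "log_norm_le I M K"
  unfolding log_norm_le_def
proof
  fix j assume j: "j \<in> I"
  with assms have m: "(\<lambda>i. M i j) \<in> l1 I" "l1_norm I (\<lambda>i. M i j) \<le> K"
    by (auto simp: cols_bounded_def)
  then show "M j j + l1_norm (I - {j}) (\<lambda>i. M i j) \<le> K"
    using l1_norm_insert[OF j m(1)] by simp
qed

lemma l1_solution_unique:
  assumes M: "cols_bounded I I M K" and x: "l1_solution I M x" and y: "l1_solution I M y"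
    and init: "\<And>i. i \<in> I \<Longrightarrow> x 0 i = y 0 i" and t: "0 \<le> t" and i: "i \<in> I"
  shows "x t i = y t i"
proof -
  note d = l1_solution_diff[OF M x y]
  have "l1_norm I (\<lambda>i. x 0 i - y 0 i) = 0"
    using l1_norm_cong[of I "\<lambda>i. x 0 i - y 0 i" "\<lambda>i. 0"] init by (simp add: l1_norm_def)
  then have "l1_norm I (\<lambda>i. x t i - y t i) \<le> 0"
    using l1_solution_norm_le[OF M cols_bounded_log_norm[OF M] d t] by simp
  then show ?thesis using l1_norm_eq_0D[OF l1_solutionD(1)[OF d t] _ i] by simp
qed

section \<open>Existence of solutions by the exponential series\<close>

lemma norm_power_difference_quotient:
  fixes s t :: real
  assumes "s \<noteq> t" "\<bar>t\<bar> \<le> R" "\<bar>s\<bar> \<le> R"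
  shows "\<bar>(s ^ n - t ^ n) / (s - t) - real n * t ^ (n - 1)\<bar>
    \<le> real n * real (n - 1) * R ^ (n - 2) * \<bar>s - t\<bar>"
proof -
  have "s - t \<noteq> 0" "norm t \<le> R" "norm (t + (s - t)) \<le> R" using assms by auto
  from lemma_termdiff3[OF this, of n] show ?thesis
    by (simp only: real_norm_def add_diff_cancel_left' diff_add_cancel add.commute[of t] One_nat_def)
qed

lemma funpow_mat_vec_l1:
  assumes M: "cols_bounded I I M K" and x: "x \<in> l1 I"
  shows "(mat_vec I M ^^ n) x \<in> l1 I \<and> l1_norm I ((mat_vec I M ^^ n) x) \<le> K ^ n * l1_norm I x"
proof (induction n)
  case (Suc n)
  let ?y = "(mat_vec I M ^^ n) x"
  have "l1_norm I (mat_vec I M ?y) \<le> K * l1_norm I ?y"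
    using mat_vec_l1(2)[OF M] Suc by blast
  also have "\<dots> \<le> K * (K ^ n * l1_norm I x)"
    using Suc M by (intro mult_left_mono) (simp_all add: cols_bounded_def)
  finally show ?case using mat_vec_l1(1)[OF M, of ?y] Suc by (simp add: mult.assoc)
qed (use x in simp)

text \<open>Differentiability in norm, and not only by coordinates, comes from bounding the Taylor
  remainder of each power by \<open>\<bar>s - t\<bar>\<close> times a coefficient whose series
  converges.\<close>

lemma l1_solution_exists:
  assumes M: "cols_bounded I I M K" and x0: "x0 \<in> l1 I"
  shows "\<exists>x. l1_solution I M x \<and> (\<forall>i\<in>I. x 0 i = x0 i)"
proof -
  define v where "v n = (mat_vec I M ^^ n) x0" for n
  define N where "N = l1_norm I x0"
  have K: "0 \<le> K" using M by (simp add: cols_bounded_def)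
  have N: "0 \<le> N" by (simp add: N_def l1_norm_nonneg)
  have v: "v n \<in> l1 I" and vn: "l1_norm I (v n) \<le> K ^ n * N" for n
    using funpow_mat_vec_l1[OF M x0] by (auto simp: v_def N_def)
  have Mv: "mat_vec I M (v n) = v (Suc n)" for n by (simp add: v_def)
  \<comment> \<open>A majorant test used twice: for the solution itself, with
    \<open>C n = \<bar>t\<bar> ^ n / fact n\<close>, and for the remainders of the difference
    quotient.\<close>
  have series: "(\<lambda>n. l1_norm I (\<lambda>i. c n * v n i)) summable_on UNIV"
      "(\<Sum>\<^sub>\<infinity>n. l1_norm I (\<lambda>i. c n * v n i)) \<le> S"
    if "((\<lambda>n. C n * K ^ n * N) has_sum S) UNIV" and "\<And>n. \<bar>c n\<bar> \<le> C n" for c C S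
  proof -
    have le: "l1_norm I (\<lambda>i. c n * v n i) \<le> C n * K ^ n * N" for n
    proof -
      have "\<bar>c n\<bar> * l1_norm I (v n) \<le> C n * (K ^ n * N)"
        using that(2)[of n] vn[of n] order_trans[OF abs_ge_zero that(2)]
        by (intro mult_mono) (auto simp: l1_norm_nonneg)
      then show ?thesis by (simp add: l1_norm_scale mult.assoc)
    qed
    have C: "(\<lambda>n. C n * K ^ n * N) summable_on UNIV" using that(1) by (rule has_sum_imp_summable)
    show s: "(\<lambda>n. l1_norm I (\<lambda>i. c n * v n i)) summable_on UNIV"
      by (rule summable_on_comparison_test[OF C]) (use le l1_norm_nonneg in auto)
    show "(\<Sum>\<^sub>\<infinity>n. l1_norm I (\<lambda>i. c n * v n i)) \<le> S"
      using infsum_mono[OF s C le] infsumI[OF that(1)] by simp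
  qed
  have exp_sum: "((\<lambda>n. z ^ n / fact n) has_sum exp z) UNIV" if "0 \<le> z" for z :: real
    using sums_nonneg_imp_has_sum[of "\<lambda>n. z ^ n / fact n" "exp z"] exp_converges[of z] that
    by (simp add: scaleR_conv_of_real divide_inverse mult.commute)
  define x where "x t i = (\<Sum>\<^sub>\<infinity>n. t ^ n / fact n * v n i)" for t i
  have exp_bound: "((\<lambda>n. R ^ n / fact n * K ^ n * N) has_sum (exp (R * K) * N)) UNIV" if "0 \<le> R" for R
    using has_sum_cmult_left[OF exp_sum[of "R * K"], of N] that K by (simp add: power_mult_distrib)
  have term_l1: "(\<lambda>i. c * v n i) \<in> l1 I" for c n by (rule l1_scale[OF v])
  have norms: "(\<lambda>n. l1_norm I (\<lambda>i. t ^ n / fact n * v n i)) summable_on UNIV" for t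
    by (rule series(1)[OF exp_bound[of "\<bar>t\<bar>"]]) (auto simp: power_abs)
  have x_l1: "x t \<in> l1 I" for t
    unfolding x_def[abs_def] by (rule l1_infsum_mem[OF term_l1 norms])
  have x_coord: "(\<lambda>n. t ^ n / fact n * v n i) summable_on UNIV" if "i \<in> I" for t i
    by (rule l1_infsum_coord[OF term_l1 norms that])
  \<comment> \<open>Applying the matrix shifts \<open>v n\<close> to \<open>v (Suc n)\<close>, which
    is the formal derivative of the series. Its term at \<open>n = 0\<close> vanishes through the
    factor \<open>real n\<close>, so the truncated \<open>n - 1\<close> is harmless and the index
    set \<open>range Suc\<close> can be enlarged to all indices.\<close>
  have deriv: "((\<lambda>n. real n * t ^ (n - 1) / fact n * v n i) has_sum mat_vec I M (x t) i) UNIV"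
    if i: "i \<in> I" for t i
  proof -
    have "mat_vec I M (x t) i = (\<Sum>\<^sub>\<infinity>n. mat_vec I M (\<lambda>i. t ^ n / fact n * v n i) i)"
      unfolding x_def[abs_def] by (rule mat_vec_infsum[OF M i term_l1 norms])
    also have "\<dots> = (\<Sum>\<^sub>\<infinity>n. t ^ n / fact n * v (Suc n) i)"
      by (simp only: mat_vec_scale Mv)
    finally have eq: "mat_vec I M (x t) i = (\<Sum>\<^sub>\<infinity>n. t ^ n / fact n * v (Suc n) i)" .
    have "(\<lambda>n. mat_vec I M (\<lambda>i. t ^ n / fact n * v n i) i) summable_on UNIV"
    proof (rule l1_infsum_coord[OF _ _ i])
      show "mat_vec I M (\<lambda>i. t ^ n / fact n * v n i) \<in> l1 I" for n
        by (rule mat_vec_l1(1)[OF M term_l1])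
      show "(\<lambda>n. l1_norm I (mat_vec I M (\<lambda>i. t ^ n / fact n * v n i))) summable_on UNIV"
        by (rule summable_on_comparison_test[OF summable_on_cmult_right[OF norms, of K]],
            rule mat_vec_l1(2)[OF M term_l1], rule l1_norm_nonneg)
    qed
    then have "(\<lambda>n. t ^ n / fact n * v (Suc n) i) summable_on UNIV"
      by (simp only: mat_vec_scale Mv)
    then have "((\<lambda>n. t ^ n / fact n * v (Suc n) i) has_sum mat_vec I M (x t) i) UNIV"
      unfolding eq by (rule has_sum_infsum)
    moreover have "t ^ n / fact n * v (Suc n) i
        = (\<lambda>n. real n * t ^ (n - 1) / fact n * v n i) (Suc n)" for n
      by (simp del: of_nat_Suc)
    ultimately have "((\<lambda>n. real n * t ^ (n - 1) / fact n * v n i) has_sum mat_vec I M (x t) i) (range Suc)"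
      by (subst has_sum_reindex) (auto simp: o_def)
    moreover have "n = 0" if "n \<notin> range Suc" for n
      using that by (metis not0_implies_Suc rangeI)
    then have "((\<lambda>n. real n * t ^ (n - 1) / fact n * v n i) has_sum z) (range Suc)
        = ((\<lambda>n. real n * t ^ (n - 1) / fact n * v n i) has_sum z) UNIV" for z
      by (intro has_sum_cong_neutral) auto
    ultimately show ?thesis by simp
  qed
  have sol: "l1_solution I M x"
    unfolding l1_solution_def
  proof (intro allI impI conjI)
    fix t :: real assume t: "0 \<le> t"
    show "x t \<in> l1 I" by (rule x_l1)
    show "mat_vec I M (x t) \<in> l1 I" by (rule mat_vec_l1(1)[OF M x_l1])
    \<comment> \<open>One bound for \<open>t\<close> and for all nonnegative \<open>s\<close> below
      \<open>t + 1\<close>, so that the majorant does not depend on \<open>s\<close>.\<close>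
    define R where "R = t + 1"
    have R: "0 \<le> R" using t by (simp add: R_def)
    define B where "B = K\<^sup>2 * exp (R * K) * N"
    \<comment> \<open>The terms \<open>n = 0\<close> and \<open>n = 1\<close> vanish; shifting the
      others by 2 cancels the factor \<open>n (n - 1)\<close> against the factorial and leaves
      \<open>K\<^sup>2\<close> times the exponential series.\<close>
    have second: "((\<lambda>n. real n * real (n - 1) * R ^ (n - 2) / fact n * K ^ n * N) has_sum B) UNIV"
    proof -
      let ?g = "\<lambda>n. real n * real (n - 1) * R ^ (n - 2) / fact n * K ^ n * N"
      have "((\<lambda>n. K\<^sup>2 * (R ^ n / fact n * K ^ n * N)) has_sum B) UNIV"
        using has_sum_cmult_right[OF exp_bound[OF R], of "K\<^sup>2"] by (simp add: B_def mult.assoc)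
      moreover have "K\<^sup>2 * (R ^ n / fact n * K ^ n * N) = ?g (n + 2)" for n
      proof -
        have "(fact (n + 2) :: real) = real (n + 2) * real (n + 1) * fact n"
          by (simp add: add_2_eq_Suc' del: of_nat_Suc)
        then have "real (n + 2) * real (n + 2 - 1) * R ^ (n + 2 - 2) / fact (n + 2) = R ^ n / fact n"
          by (simp del: of_nat_Suc of_nat_add fact_Suc)
        then show ?thesis by (simp only: power_add) (simp only: ac_simps)
      qed
      ultimately have "((\<lambda>n. ?g (n + 2)) has_sum B) UNIV" by (simp only:)
      then have "(?g has_sum B) (range (\<lambda>n. n + 2))"
        using has_sum_reindex[of "\<lambda>n. n + 2" UNIV ?g B] by (simp only: o_def inj_on_add' simp_thms)
      moreover have "?g n = 0" if "n \<notin> range (\<lambda>n. n + 2)" for n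
      proof -
        have "n < 2" using that by (metis le_add_diff_inverse2 not_less rangeI)
        then show ?thesis by (auto simp: less_2_cases_iff)
      qed
      then have "(?g has_sum z) (range (\<lambda>n. n + 2)) = (?g has_sum z) UNIV" for z
        by (intro has_sum_cong_neutral) auto
      ultimately show ?thesis by simp
    qed
    show "((\<lambda>s. l1_norm I (\<lambda>i. (x s i - x t i) / (s - t) - mat_vec I M (x t) i)) \<longlongrightarrow> 0)
        (at t within {0..})"
    proof (rule tendsto_sandwich[OF _ _ tendsto_const])
      have "((\<lambda>s. \<bar>s - t\<bar> * B) \<longlongrightarrow> \<bar>t - t\<bar> * B) (at t within {0..})"
        by (intro tendsto_intros)
      then show "((\<lambda>s. \<bar>s - t\<bar> * B) \<longlongrightarrow> 0) (at t within {0..})" by simp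
      have "eventually (\<lambda>s. s < R) (at t within {0..})"
        by (rule order_tendstoD(2)[OF tendsto_ident_at]) (simp add: R_def)
      then show "eventually (\<lambda>s. l1_norm I (\<lambda>i. (x s i - x t i) / (s - t) - mat_vec I M (x t) i)
          \<le> \<bar>s - t\<bar> * B) (at t within {0..})"
        using eventually_at_within_mem[of "{0..}" t]
      proof eventually_elim
        case (elim s)
        define c where "c n = ((s ^ n - t ^ n) / (s - t) - real n * t ^ (n - 1)) / fact n" for n
        have c_le: "\<bar>c n\<bar> \<le> \<bar>s - t\<bar> * (real n * real (n - 1) * R ^ (n - 2) / fact n)" for n
        proof -
          have "\<bar>(s ^ n - t ^ n) / (s - t) - real n * t ^ (n - 1)\<bar> / fact n
              \<le> real n * real (n - 1) * R ^ (n - 2) * \<bar>s - t\<bar> / fact n"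
            using elim t by (intro divide_right_mono norm_power_difference_quotient) (auto simp: R_def)
          then show ?thesis by (simp add: c_def mult.commute)
        qed
        have bnd: "((\<lambda>n. \<bar>s - t\<bar> * (real n * real (n - 1) * R ^ (n - 2) / fact n) * K ^ n * N)
            has_sum \<bar>s - t\<bar> * B) UNIV"
          using has_sum_cmult_right[OF second, of "\<bar>s - t\<bar>"] by (simp add: mult.assoc)
        have coord: "(x s i - x t i) / (s - t) - mat_vec I M (x t) i = (\<Sum>\<^sub>\<infinity>n. c n * v n i)"
          if i: "i \<in> I" for i
        proof -
          have "((\<lambda>n. (s ^ n / fact n * v n i + (-1) * (t ^ n / fact n * v n i)) * (1 / (s - t))
              + (-1) * (real n * t ^ (n - 1) / fact n * v n i))
            has_sum (x s i + (-1) * x t i) * (1 / (s - t)) + (-1) * mat_vec I M (x t) i) UNIV"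
            unfolding x_def[of s i] x_def[of t i]
            by (intro has_sum_add has_sum_cmult_left has_sum_cmult_right deriv[OF i] has_sum_infsum x_coord i)
          moreover have "(s ^ n / fact n * v n i + (-1) * (t ^ n / fact n * v n i)) * (1 / (s - t))
              + (-1) * (real n * t ^ (n - 1) / fact n * v n i) = c n * v n i" for n
          proof -
            have "(S / F * V + (-1) * (T / F * V)) * (1 / h) + (-1) * (D / F * V)
              = ((S - T) / h - D) / F * V" for S T F V h D :: real
              by (simp add: algebra_simps add_divide_distrib diff_divide_distrib)
            then show ?thesis unfolding c_def .
          qed
          ultimately have "((\<lambda>n. c n * v n i) has_sum
              (x s i + (-1) * x t i) * (1 / (s - t)) + (-1) * mat_vec I M (x t) i) UNIV"
            by (simp only:)
          then show ?thesis by (simp add: infsumI)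
        qed
        have "l1_norm I (\<lambda>i. (x s i - x t i) / (s - t) - mat_vec I M (x t) i)
            = l1_norm I (\<lambda>i. \<Sum>\<^sub>\<infinity>n. c n * v n i)"
          by (rule l1_norm_cong[OF coord])
        also have "\<dots> \<le> (\<Sum>\<^sub>\<infinity>n. l1_norm I (\<lambda>i. c n * v n i))"
          by (rule l1_infsum_norm[OF term_l1 series(1)[OF bnd c_le]])
        also have "\<dots> \<le> \<bar>s - t\<bar> * B" by (rule series(2)[OF bnd c_le])
        finally show ?case .
      qed
    qed (simp add: l1_norm_nonneg)
  qed
  have "x 0 i = x0 i" for i
  proof -
    have "((\<lambda>n. 0 ^ n / fact n * v n i) has_sum x0 i) UNIV"
      by (rule has_sum_finite_neutralI[of "{0}"]) (auto simp: v_def)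
    then show ?thesis unfolding x_def by (rule infsumI)
  qed
  with sol show ?thesis by blast
qed

section \<open>The matrices of the queue\<close>

lemma pmf_summable_on: "pmf p summable_on X"
proof -
  have "(\<lambda>x. norm (pmf p x)) summable_on X"
    unfolding abs_summable_equivalent by (rule pmf_abs_summable)
  then show ?thesis by simp
qed

lemma pmf_has_sum_1: "(pmf p has_sum 1) UNIV"
proof -
  have "infsum (pmf p) UNIV = infsetsum (pmf p) UNIV"
    using infsetsum_infsum[OF pmf_abs_summable[of p UNIV]] by simp
  then show ?thesis
    using infsetsum_pmf_eq_1[of p UNIV] has_sum_infsum[OF pmf_summable_on[of p UNIV]] by simp
qed

lemma has_sum_minus:
  fixes f g :: "'a \<Rightarrow> real"
  assumes "(f has_sum a) X" "(g has_sum c) X"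
  shows "((\<lambda>x. f x - g x) has_sum (a - c)) X"
proof -
  have "((\<lambda>x. - g x) has_sum - c) X" using assms(2) by (simp add: has_sum_uminus)
  from has_sum_add[OF assms(1) this] show ?thesis by simp
qed


lemma batch_tail_has_sum: "(pmf b has_sum batch_tail b k) {k..}"
  unfolding batch_tail_def by (rule has_sum_infsum[OF pmf_summable_on])

lemma batch_tail_nonneg: "0 \<le> batch_tail b k"
  by (rule has_sum_nonneg[OF batch_tail_has_sum]) simp

lemma batch_tail_le_1: "batch_tail b k \<le> 1"
  using has_sum_mono2[OF batch_tail_has_sum pmf_has_sum_1[of b], of k] by simp

lemma batch_tail_rec: "batch_tail b k = pmf b k + batch_tail b (Suc k)"
proof -
  have "{k..} = insert k {Suc k..}" by auto
  then show ?thesis unfolding batch_tail_def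
    by (simp add: infsum_insert[OF pmf_summable_on])
qed

lemma state_space_downward: "i \<in> state_space b \<Longrightarrow> j \<le> i \<Longrightarrow> j \<in> state_space b"
  by (auto simp: state_space_def split: if_splits)

lemma zero_in_state_space [simp]: "0 \<in> state_space b"
  by (simp add: state_space_def)

lemma not_in_state_space_le: "i \<notin> state_space b \<Longrightarrow> i \<le> j \<Longrightarrow> j \<notin> state_space b"
  using state_space_downward by blast

lemma pmf_outside_state_space: "i \<notin> state_space b \<Longrightarrow> pmf b i = 0"
proof (rule ccontr)
  assume i: "i \<notin> state_space b" and "pmf b i \<noteq> 0"
  then have "i \<in> set_pmf b" by (simp add: set_pmf_iff)
  with i show False by (cases "finite (set_pmf b)") (auto simp: state_space_def)
qed

lemma batch_tail_outside_state_space: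
  assumes "i \<notin> state_space b" shows "batch_tail b i = 0"
  unfolding batch_tail_def
  using pmf_outside_state_space not_in_state_space_le[OF assms] by (intro infsum_0) auto

lemma pos_states_iff: "i \<in> pos_states b \<longleftrightarrow> i \<in> state_space b \<and> i \<noteq> 0"
  by (auto simp: pos_states_def)

lemma state_space_insert: "state_space b = insert 0 (pos_states b)"
  by (auto simp: pos_states_def)

text \<open>Row \<open>i\<close> of the transposed generator is zero beyond column
  \<open>Suc i\<close>, and all columns below \<open>i\<close> share the entry
  \<open>lam * pmf b i\<close>, since a batch of size \<open>i\<close> replaces any smaller
  population. The condition on \<open>z\<close> makes the formula valid at the largest state as
  well. It serves the intertwining relation and the stationary vector alike.\<close>

lemma kolmogorov_mat_apply:
  assumes i: "i \<in> state_space b" and z: "Suc i \<notin> state_space b \<Longrightarrow> z (Suc i) = 0"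
  shows "mat_vec (state_space b) (kolmogorov_mat b lam mu) z i =
    lam * pmf b i * (\<Sum>j<i. z j) + mu * z (Suc i)
    - (if i = 0 then lam else mu + lam * batch_tail b (Suc i)) * z i"
proof -
  let ?f = "\<lambda>j. kolmogorov_mat b lam mu i j * z j"
  have zz: "Suc i \<in> state_space b \<or> z (Suc i) = 0" using z by blast
  have "(?f has_sum (\<Sum>j\<in>{..Suc i} \<inter> state_space b. ?f j)) (state_space b)"
    by (rule has_sum_finite_neutralI[of "{..Suc i} \<inter> state_space b"])
      (auto simp: kolmogorov_mat_def intensity_def)
  also have "(\<Sum>j\<in>{..Suc i} \<inter> state_space b. ?f j) = (\<Sum>j\<in>{..Suc i}. ?f j)"
    using zz state_space_downward[OF i]
    by (intro sum.mono_neutral_left) (auto simp: le_Suc_eq)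
  also have "\<dots> = (\<Sum>j<i. ?f j) + ?f i + ?f (Suc i)"
    by (simp add: lessThan_Suc_atMost[symmetric])
  also have "(\<Sum>j<i. ?f j) = lam * pmf b i * (\<Sum>j<i. z j)"
    unfolding sum_distrib_left by (intro sum.cong) (auto simp: kolmogorov_mat_def intensity_def)
  also have "?f i = - ((if i = 0 then lam else mu + lam * batch_tail b (Suc i)) * z i)"
    by (simp add: kolmogorov_mat_def intensity_def algebra_simps)
  also have "?f (Suc i) = mu * z (Suc i)"
    by (simp add: kolmogorov_mat_def intensity_def)
  finally have "(?f has_sum (lam * pmf b i * (\<Sum>j<i. z j) + mu * z (Suc i)
    - (if i = 0 then lam else mu + lam * batch_tail b (Suc i)) * z i)) (state_space b)"
    by (simp only: add_uminus_conv_diff diff_add_eq)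
  then show ?thesis unfolding mat_vec_def by (rule infsumI)
qed


lemma cols_boundedI:
  assumes "\<And>j. j \<in> I \<Longrightarrow> ((\<lambda>i. \<bar>M i j\<bar>) has_sum c j) (I - {j})"
    and "\<And>j. j \<in> I \<Longrightarrow> \<bar>M j j\<bar> + c j \<le> K" and "0 \<le> K"
  shows "cols_bounded I I M K"
  unfolding cols_bounded_def
proof (intro conjI ballI)
  fix j assume j: "j \<in> I"
  have "((\<lambda>i. \<bar>M i j\<bar>) has_sum (\<bar>M j j\<bar> + c j)) (insert j (I - {j}))"
    by (rule has_sum_insert) (use assms(1)[OF j] in auto)
  then have "((\<lambda>i. \<bar>M i j\<bar>) has_sum (\<bar>M j j\<bar> + c j)) I"
    using j by (simp add: insert_absorb)
  then show "(\<lambda>i. M i j) \<in> l1 I" "l1_norm I (\<lambda>i. M i j) \<le> K"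
    using assms(2)[OF j] by (auto simp: l1_def l1_norm_def has_sum_iff)
qed (rule assms(3))

section \<open>The weights and the constant \<open>W_const\<close>\<close>

lemma weight_pos: "0 < \<delta> \<Longrightarrow> 0 < weight \<delta> k"
  by (simp add: weight_def)

lemma weight_ge_1: "0 < \<delta> \<Longrightarrow> \<delta> < 1 \<Longrightarrow> 1 \<le> weight \<delta> k"
  unfolding weight_def by (rule one_le_power) simp

lemma weight_Suc: "0 < \<delta> \<Longrightarrow> 1 \<le> k \<Longrightarrow> weight \<delta> k / weight \<delta> (Suc k) = \<delta>"
  by (cases k) (simp_all add: weight_def)

text \<open>\<open>\<delta> ^ (k - 1)\<close> is the smallest of the first \<open>k\<close> powers,
  so \<open>k\<close> times it is at most their sum, which is below
  \<open>1 / (1 - \<delta>)\<close>. This bounds \<open>W_const \<delta>\<close> away from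
  0.\<close>

lemma weight_ratio_ge:
  assumes \<delta>: "0 < \<delta>" "\<delta> < 1" and k: "1 \<le> k"
  shows "1 - \<delta> \<le> weight \<delta> k / real k"
proof -
  have "real k * \<delta> ^ (k - 1) = (\<Sum>j<k. \<delta> ^ (k - 1))" by simp
  also have "\<dots> \<le> (\<Sum>j<k. \<delta> ^ j)"
    using \<delta> by (intro sum_mono power_decreasing) auto
  also have "\<dots> = (1 - \<delta> ^ k) / (1 - \<delta>)" using \<delta> by (simp add: sum_gp_strict)
  also have "\<dots> \<le> 1 / (1 - \<delta>)" using \<delta> by (intro divide_right_mono) auto
  finally have "real k * \<delta> ^ (k - 1) * (1 - \<delta>) \<le> 1" using \<delta> by (simp add: pos_le_divide_eq)
  then have "(1 - \<delta>) * real k \<le> 1 / \<delta> ^ (k - 1)"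
    using \<delta> by (simp add: pos_le_divide_eq mult.commute mult.left_commute)
  then have "1 - \<delta> \<le> (1 / \<delta> ^ (k - 1)) / real k" using k by (subst pos_le_divide_eq) auto
  then show ?thesis by (simp add: weight_def power_one_over)
qed

lemma W_const:
  assumes \<delta>: "0 < \<delta>" "\<delta> < 1"
  shows W_const_pos: "0 < W_const \<delta>"
    and W_const_le: "1 \<le> k \<Longrightarrow> real k / weight \<delta> k \<le> 1 / W_const \<delta>"
proof -
  have "1 - \<delta> \<le> W_const \<delta>"
    unfolding W_const_def by (rule cINF_greatest) (use weight_ratio_ge[OF \<delta>] in auto)
  then show pos: "0 < W_const \<delta>" using \<delta> by simp
  have bdd: "bdd_below ((\<lambda>k. weight \<delta> k / real k) ` {1..})"
    by (rule bdd_belowI2[of _ "1 - \<delta>"]) (use weight_ratio_ge[OF \<delta>] in auto)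
  assume k: "1 \<le> k"
  then have "W_const \<delta> \<le> weight \<delta> k / real k"
    unfolding W_const_def by (intro cINF_lower[OF bdd]) simp
  then show "real k / weight \<delta> k \<le> 1 / W_const \<delta>"
    using k pos weight_pos[OF \<delta>(1), of k] by (simp add: field_simps)
qed

section \<open>Entries of \<open>B_star2\<close> and the left inverse of \<open>D T\<close>\<close>

lemma mat_mul_diag_left:
  assumes "i \<in> X" shows "mat_mul X (diag_mat d) M i j = d i * M i j"
  unfolding mat_mul_def
  by (rule infsumI, rule has_sum_finite_neutralI[of "{i}"]) (use assms in \<open>auto simp: diag_mat_def\<close>)

lemma mat_mul_diag_right:
  assumes "j \<in> X" shows "mat_mul X M (diag_mat d) i j = M i j * d j"
  unfolding mat_mul_def
  by (rule infsumI, rule has_sum_finite_neutralI[of "{j}"]) (use assms in \<open>auto simp: diag_mat_def\<close>)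

lemma mat_vec_diag:
  assumes "i \<in> X" shows "mat_vec X (diag_mat d) x i = d i * x i"
  unfolding mat_vec_def
  by (rule infsumI, rule has_sum_finite_neutralI[of "{i}"]) (use assms in \<open>auto simp: diag_mat_def\<close>)

lemma B_star2_eq:
  assumes "i \<in> pos_states b" "j \<in> pos_states b"
  shows "B_star2 b lam mu \<delta> i j = weight \<delta> i * B_star b lam mu i j / weight \<delta> j"
  using assms unfolding B_star2_def D_mat_def D_inv_mat_def
  by (simp add: mat_mul_diag_left mat_mul_diag_right)

text \<open>Left inverse of \<open>w = D T z\<close>, recovering also the deleted coordinate of a vector of total mass 0.\<close>

definition DT_inv_mat :: "real \<Rightarrow> nat \<Rightarrow> nat \<Rightarrow> real" where
  "DT_inv_mat \<delta> i j = (if i = j then 1 / weight \<delta> j else 0) - (if j = Suc i then 1 / weight \<delta> j else 0)"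

text \<open>Undoing \<open>D\<close> yields the tail sums \<open>T z\<close>. The value 0 above the
  largest state is that of an empty tail, and at index 0 it is the vanishing total mass of a
  difference of probability vectors; with both, consecutive differences give \<open>z\<close> at
  every state.\<close>

definition tails :: "nat pmf \<Rightarrow> real \<Rightarrow> (nat \<Rightarrow> real) \<Rightarrow> nat \<Rightarrow> real" where
  "tails b \<delta> w i = (if i \<in> pos_states b then w i / weight \<delta> i else 0)"

lemma DT_inv_apply: "mat_vec (pos_states b) (DT_inv_mat \<delta>) w i = tails b \<delta> w i - tails b \<delta> w (Suc i)"
proof -
  let ?J = "pos_states b"
  have "((\<lambda>j. if k = j then w j / weight \<delta> j else 0) has_sum tails b \<delta> w k) ?J" for k
    by (rule has_sum_finite_neutralI[of "{k} \<inter> ?J"]) (auto simp: tails_def)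
  from has_sum_minus[OF this[of i] this[of "Suc i"]]
  have "((\<lambda>j. DT_inv_mat \<delta> i j * w j) has_sum (tails b \<delta> w i - tails b \<delta> w (Suc i))) ?J"
    by (rule has_sum_cong[THEN iffD1, rotated]) (auto simp: DT_inv_mat_def)
  then show ?thesis unfolding mat_vec_def by (rule infsumI)
qed

lemma tails_0: "tails b \<delta> w 0 = 0"
  by (simp add: tails_def pos_states_def)

lemma tails_outside: "Suc i \<notin> state_space b \<Longrightarrow> tails b \<delta> w (Suc i) = 0"
  by (simp add: tails_def pos_states_def)

lemma B_star2_apply:
  assumes \<delta>: "0 < \<delta>" and i: "i \<in> pos_states b"
  shows "mat_vec (pos_states b) (B_star2 b lam mu \<delta>) w i
    = weight \<delta> i * (mu * tails b \<delta> w (Suc i) - (mu + lam * batch_tail b i) * tails b \<delta> w i)"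
proof -
  let ?J = "pos_states b"
  have "((\<lambda>j. if k = j then w j / weight \<delta> j else 0) has_sum tails b \<delta> w k) ?J" for k
    by (rule has_sum_finite_neutralI[of "{k} \<inter> ?J"]) (auto simp: tails_def)
  note s = this
  have "((\<lambda>j. weight \<delta> i * (mu * (if Suc i = j then w j / weight \<delta> j else 0)
      - (mu + lam * batch_tail b i) * (if i = j then w j / weight \<delta> j else 0))) has_sum
    weight \<delta> i * (mu * tails b \<delta> w (Suc i) - (mu + lam * batch_tail b i) * tails b \<delta> w i)) ?J"
    by (intro has_sum_cmult_right has_sum_minus s)
  then have "((\<lambda>j. B_star2 b lam mu \<delta> i j * w j) has_sum
    weight \<delta> i * (mu * tails b \<delta> w (Suc i) - (mu + lam * batch_tail b i) * tails b \<delta> w i)) ?J"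
    by (rule has_sum_cong[THEN iffD1, rotated]) (auto simp: B_star2_eq[OF i] B_star_def simp del: minus_add_distrib)
  then show ?thesis unfolding mat_vec_def by (rule infsumI)
qed

text \<open>In tail coordinates the conjugation by \<open>D\<close> disappears and
  \<open>B_star\<close> remains. The formula also covers indices above the largest state, where both
  sides are 0, so that it can be used at \<open>i\<close> and \<open>Suc i\<close> without case
  distinction.\<close>

lemma tails_B_star2:
  assumes \<delta>: "0 < \<delta>" and i: "0 < i"
  shows "tails b \<delta> (mat_vec (pos_states b) (B_star2 b lam mu \<delta>) w) i
    = mu * tails b \<delta> w (Suc i) - (mu + lam * batch_tail b i) * tails b \<delta> w i"
proof (cases "i \<in> pos_states b")
  case True
  then show ?thesis
    using B_star2_apply[OF \<delta> True] weight_pos[OF \<delta>, of i] by (simp add: tails_def[of _ _ _ i])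
next
  case False
  then have "i \<notin> state_space b" using i by (simp add: pos_states_iff)
  then have "Suc i \<notin> pos_states b" using not_in_state_space_le[of i b "Suc i"] by (simp add: pos_states_iff)
  with False show ?thesis by (simp add: tails_def)
qed

text \<open>Column \<open>j\<close> has two nonzero entries, of size
  \<open>1 / weight \<delta> j\<close>, in rows \<open>j\<close> and \<open>j - 1\<close>. With row
  weights \<open>g\<close> its norm is \<open>(g j + g (j - 1)) / weight \<delta> j\<close>; the
  cases \<open>g = 1\<close> and \<open>g = real\<close> give the two bounds.\<close>

lemma DT_inv_cols_bounded:
  assumes \<delta>: "0 < \<delta>" "\<delta> < 1"
  shows "cols_bounded (state_space b) (pos_states b) (DT_inv_mat \<delta>) 2"
    and "cols_bounded (state_space b) (pos_states b) (\<lambda>i j. real i * DT_inv_mat \<delta> i j) (2 / W_const \<delta>)"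
proof -
  let ?I = "state_space b"
  have col: "((\<lambda>i. \<bar>g i * DT_inv_mat \<delta> i j\<bar>) has_sum (g j + g (j - 1)) / weight \<delta> j) ?I"
    if j: "j \<in> pos_states b" and g: "\<And>i. 0 \<le> g i" for g :: "nat \<Rightarrow> real" and j
  proof (rule has_sum_finite_neutralI[of "{j, j - 1}"])
    have "j \<noteq> 0" "j \<in> ?I" using j by (auto simp: pos_states_iff)
    then show "{j, j - 1} \<subseteq> ?I" using state_space_downward[of j b "j - 1"] by auto
    show "(g j + g (j - 1)) / weight \<delta> j = (\<Sum>i\<in>{j, j - 1}. \<bar>g i * DT_inv_mat \<delta> i j\<bar>)"
      using \<open>j \<noteq> 0\<close> g weight_pos[OF \<delta>(1), of j]
      by (cases j) (simp_all add: DT_inv_mat_def abs_mult add_divide_distrib)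
  qed (auto simp: DT_inv_mat_def)
  show "cols_bounded ?I (pos_states b) (DT_inv_mat \<delta>) 2"
    unfolding cols_bounded_def
  proof (intro conjI ballI)
    fix j assume j: "j \<in> pos_states b"
    have "((\<lambda>i. \<bar>DT_inv_mat \<delta> i j\<bar>) has_sum 2 / weight \<delta> j) ?I"
      using col[OF j, of "\<lambda>_. 1"] by simp
    moreover have "2 / weight \<delta> j \<le> 2" using weight_ge_1[OF \<delta>, of j] by (simp add: divide_le_eq)
    ultimately show "(\<lambda>i. DT_inv_mat \<delta> i j) \<in> l1 ?I" "l1_norm ?I (\<lambda>i. DT_inv_mat \<delta> i j) \<le> 2"
      by (auto simp: l1_def l1_norm_def has_sum_iff)
  qed simp
  show "cols_bounded ?I (pos_states b) (\<lambda>i j. real i * DT_inv_mat \<delta> i j) (2 / W_const \<delta>)"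
    unfolding cols_bounded_def
  proof (intro conjI ballI)
    fix j assume j: "j \<in> pos_states b"
    have "(real j + real (j - 1)) / weight \<delta> j \<le> (2 * real j) / weight \<delta> j"
      using weight_pos[OF \<delta>(1), of j] by (intro divide_right_mono) auto
    also have "\<dots> \<le> 2 / W_const \<delta>"
      using W_const_le[OF \<delta>, of j] j by (simp add: pos_states_iff)
    finally show "(\<lambda>i. real i * DT_inv_mat \<delta> i j) \<in> l1 ?I"
      "l1_norm ?I (\<lambda>i. real i * DT_inv_mat \<delta> i j) \<le> 2 / W_const \<delta>"
      using col[OF j, of real] by (auto simp: l1_def l1_norm_def has_sum_iff)
  qed (use W_const_pos[OF \<delta>] in simp)
qed

section \<open>Geometric bounds\<close>

lemma geometric_has_sum:
  fixes r :: real
  assumes r: "0 \<le> r" "r < 1"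
  shows "((\<lambda>n. r ^ n) has_sum r ^ k / (1 - r)) {k..}"
proof -
  have "((\<lambda>n. r ^ n) has_sum 1 / (1 - r)) UNIV"
    using sums_nonneg_imp_has_sum[of "\<lambda>n. r ^ n"] geometric_sums[of r] r by simp
  from has_sum_cmult_right[OF this, of "r ^ k"]
  have "((\<lambda>n. r ^ (n + k)) has_sum r ^ k / (1 - r)) UNIV"
    by (simp add: power_add mult.commute)
  then have "((\<lambda>n. r ^ n) has_sum r ^ k / (1 - r)) ((\<lambda>n. n + k) ` UNIV)"
    by (subst has_sum_reindex) (auto simp: o_def)
  moreover have "(\<lambda>n. n + k) ` UNIV = {k..}"
    by (auto simp: image_iff) (metis add.commute le_Suc_ex)
  ultimately show ?thesis by simp
qed

lemma geometric_summable_on: "0 \<le> r \<Longrightarrow> r < 1 \<Longrightarrow> (\<lambda>n. r ^ n) summable_on X" for r :: real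
  using summable_on_subset_banach[OF has_sum_imp_summable[OF geometric_has_sum[of r 0]], of X]
  by (simp add: atLeast_0)

lemma weight_le_power:
  assumes "0 < \<delta>" "\<delta> < 1" shows "weight \<delta> i \<le> (1 / \<delta>) ^ i"
  unfolding weight_def using assms by (intro power_increasing) auto

lemma real_le_power_div_W:
  assumes \<delta>: "0 < \<delta>" "\<delta> < 1" shows "real n \<le> 1 / W_const \<delta> * (1 / \<delta>) ^ n"
proof (cases "n = 0")
  case False
  have "real n \<le> 1 / W_const \<delta> * weight \<delta> n"
    using W_const_le[OF \<delta>, of n] False weight_pos[OF \<delta>(1), of n] by (simp add: pos_divide_le_eq)
  also have "\<dots> \<le> 1 / W_const \<delta> * (1 / \<delta>) ^ n"
    using weight_le_power[OF \<delta>, of n] W_const_pos[OF \<delta>] by (intro mult_left_mono) auto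
  finally show ?thesis .
qed (use W_const_pos[OF \<delta>] in simp)

lemma power_ratio_summable:
  fixes q \<delta> :: real
  assumes "0 < q" "q < \<delta>" shows "(\<lambda>i. c * ((1 / \<delta>) ^ i * q ^ i)) summable_on X"
  using geometric_summable_on[of "q / \<delta>" X] assms
  by (intro summable_on_cmult_right) (simp add: power_divide)

lemma l1_comparison:
  assumes "g summable_on X" "\<And>i. i \<in> X \<Longrightarrow> \<bar>x i\<bar> \<le> g i"
  shows "x \<in> l1 X"
  unfolding l1_def mem_Collect_eq
  by (rule summable_on_comparison_test[OF assms(1)]) (use assms(2) in auto)

lemma geometric_imp_l1:
  fixes q :: real
  assumes "0 < q" "q < 1" "\<And>i. i \<in> X \<Longrightarrow> \<bar>x i\<bar> \<le> c * q ^ i"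
  shows "x \<in> l1 X"
  by (rule l1_comparison[OF summable_on_cmult_right[OF geometric_summable_on[of q], of c]])
    (use assms in auto)

text \<open>Some \<open>\<delta>\<close> between \<open>q\<close> and 1 absorbs the factor
  \<open>n\<close>, which is at most a multiple of \<open>(1 / \<delta>) ^ n\<close>; a geometric
  series of ratio \<open>q / \<delta>\<close> remains.\<close>

lemma geometric_imp_finite_mean:
  assumes q: "0 < q" "q < 1" and x: "\<And>i. i \<in> X \<Longrightarrow> \<bar>x i\<bar> \<le> c * q ^ i"
  shows "(\<lambda>n. real n * x n) \<in> l1 X"
proof -
  obtain \<delta> where \<delta>: "q < \<delta>" "\<delta> < 1" using dense[OF q(2)] by blast
  have "\<bar>real n * x n\<bar> \<le> (1 / W_const \<delta> * c) * ((1 / \<delta>) ^ n * q ^ n)" if "n \<in> X" for n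
  proof -
    have "\<bar>real n * x n\<bar> \<le> (1 / W_const \<delta> * (1 / \<delta>) ^ n) * (c * q ^ n)"
      using real_le_power_div_W[of \<delta> n] q \<delta> x[OF that] W_const_pos[of \<delta>]
      unfolding abs_mult by (intro mult_mono) auto
    then show ?thesis by (simp add: mult_ac)
  qed
  then show ?thesis by (rule l1_comparison[OF power_ratio_summable[OF q(1) \<delta>(1)]])
qed

section \<open>Decay estimates\<close>

locale queue =
  fixes b :: "nat pmf" and lam mu :: real
  assumes no_empty_batch: "0 \<notin> set_pmf b" and lam_nonneg: "0 \<le> lam" and mu_pos: "0 < mu"
begin

abbreviation "I \<equiv> state_space b"
abbreviation "J \<equiv> pos_states b"
abbreviation "A \<equiv> kolmogorov_mat b lam mu"

section \<open>Column sums of the Kolmogorov matrix and of \<open>B_star2\<close>\<close>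

lemma pmf_0: "pmf b 0 = 0"
  using no_empty_batch by (simp add: set_pmf_iff)

lemma batch_tail_1: "batch_tail b (Suc 0) = 1"
  using batch_tail_rec[of b 0] pmf_0 infsumI[OF pmf_has_sum_1[of b]] by (simp add: batch_tail_def atLeast_0)

lemma one_in_pos_states: "1 \<in> J"
proof (rule ccontr)
  assume "1 \<notin> J"
  then have "Suc 0 \<notin> I" by (simp add: pos_states_iff)
  then show False using batch_tail_outside_state_space batch_tail_1 by fastforce
qed

lemma kolmogorov_mat_column:
  assumes j: "j \<in> I"
  shows "((\<lambda>i. \<bar>A i j\<bar>) has_sum (lam * batch_tail b (Suc j) + (if j = 0 then 0 else mu))) (I - {j})"
proof -
  have "((\<lambda>i. lam * (if j < i then pmf b i else 0)) has_sum lam * batch_tail b (Suc j)) (I - {j})"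
  proof (rule has_sum_cmult_right)
    have "(pmf b has_sum batch_tail b (Suc j)) {Suc j..} =
      ((\<lambda>i. if j < i then pmf b i else 0) has_sum batch_tail b (Suc j)) (I - {j})"
      by (rule has_sum_cong_neutral) (auto simp: pmf_outside_state_space)
    then show "((\<lambda>i. if j < i then pmf b i else 0) has_sum batch_tail b (Suc j)) (I - {j})"
      using batch_tail_has_sum by blast
  qed
  moreover have "((\<lambda>i. if j = Suc i then mu else 0) has_sum (if j = 0 then 0 else mu)) (I - {j})"
    by (rule has_sum_finite_neutralI[of "if j = 0 then {} else {j - 1}"])
      (use state_space_downward[OF j, of "j - 1"] in auto)
  ultimately have "((\<lambda>i. lam * (if j < i then pmf b i else 0) + (if j = Suc i then mu else 0)) has_sum
      (lam * batch_tail b (Suc j) + (if j = 0 then 0 else mu))) (I - {j})"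
    by (rule has_sum_add)
  then show ?thesis
    by (rule has_sum_cong[THEN iffD1, rotated])
      (use lam_nonneg mu_pos in \<open>auto simp: kolmogorov_mat_def intensity_def abs_mult\<close>)
qed

text \<open>The matrix is a transposed generator: its columns sum to zero and are nonnegative off
  the diagonal. In column 0 the balance rests on \<open>batch_tail_1\<close>, that is, on the
  absence of empty batches.\<close>

lemma log_norm_kolmogorov: "log_norm_le I A 0"
  unfolding log_norm_le_def
proof
  fix j assume j: "j \<in> I"
  then show "A j j + l1_norm (I - {j}) (\<lambda>i. A i j) \<le> 0"
    unfolding l1_norm_def infsumI[OF kolmogorov_mat_column[OF j]]
    using batch_tail_1 by (simp add: kolmogorov_mat_def intensity_def)
qed

lemma cols_bounded_kolmogorov: "cols_bounded I I A (2 * (lam + mu))"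
proof (rule cols_boundedI[OF kolmogorov_mat_column])
  have le: "lam * batch_tail b (Suc j) \<le> lam" for j
    using lam_nonneg batch_tail_le_1 by (simp add: mult_left_le)
  fix j
  have "0 \<le> lam * batch_tail b (Suc j)" using lam_nonneg batch_tail_nonneg by simp
  then show "\<bar>A j j\<bar> + (lam * batch_tail b (Suc j) + (if j = 0 then 0 else mu)) \<le> 2 * (lam + mu)"
    using le[of j] mu_pos lam_nonneg by (auto simp: kolmogorov_mat_def intensity_def)
qed (use lam_nonneg mu_pos in auto)

text \<open>Off the diagonal only row \<open>j - 1\<close> contributes, where the ratio of
  consecutive weights turns \<open>mu\<close> into \<open>mu * \<delta>\<close>; for
  \<open>j = 1\<close> that row is the deleted coordinate.\<close>

lemma B_star2_column:
  assumes \<delta>: "0 < \<delta>" and j: "j \<in> J"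
  shows "((\<lambda>i. \<bar>B_star2 b lam mu \<delta> i j\<bar>) has_sum (if j = 1 then 0 else mu * \<delta>)) (J - {j})"
proof (rule has_sum_finite_neutralI[of "if j = 1 then {} else {j - 1}"])
  have j0: "j \<noteq> 0" "j \<in> I" using j by (auto simp: pos_states_iff)
  then have pred: "j - 1 \<in> J" if "j \<noteq> 1"
    using that state_space_downward[of j b "j - 1"] by (auto simp: pos_states_iff)
  then show "(if j = 1 then {} else {j - 1}) \<subseteq> J - {j}" using j0 by auto
  show "\<bar>B_star2 b lam mu \<delta> i j\<bar> = 0" if "i \<in> J - {j} - (if j = 1 then {} else {j - 1})" for i
    using that j by (auto simp: B_star2_eq B_star_def pos_states_iff split: if_splits)
  show "(if j = 1 then 0 else mu * \<delta>) = (\<Sum>i\<in>(if j = 1 then {} else {j - 1}). \<bar>B_star2 b lam mu \<delta> i j\<bar>)"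
  proof (cases "j = 1")
    case False
    with j0 obtain k where k: "j = Suc k" "1 \<le> k" using j0 by (cases j) auto
    have "B_star2 b lam mu \<delta> k j = mu * (weight \<delta> k / weight \<delta> (Suc k))"
      using pred[OF False] j k by (simp add: B_star2_eq B_star_def)
    also have "\<dots> = mu * \<delta>" using weight_Suc[OF \<delta> k(2)] by simp
    finally show ?thesis using False k mu_pos \<delta> by (simp add: abs_mult)
  qed simp
qed simp

lemma B_star2_diag:
  assumes "0 < \<delta>" "j \<in> J" shows "B_star2 b lam mu \<delta> j j = - (mu + lam * batch_tail b j)"
  using assms weight_pos[of \<delta> j] by (simp add: B_star2_eq B_star_def)

text \<open>For \<open>j > 1\<close> the column gives
  \<open>- (mu + lam * batch_tail b j) + mu * \<delta>\<close>. This is what the weights achieve: in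
  \<open>B_star\<close> the two occurrences of \<open>mu\<close> would cancel and leave
  \<open>- lam * batch_tail b j\<close>, which tends to 0 along an infinite state space.\<close>

lemma log_norm_B_star2:
  assumes \<delta>: "0 < \<delta>"
  shows "log_norm_le J (B_star2 b lam mu \<delta>) (- (1 - \<delta>) * mu)"
  unfolding log_norm_le_def
proof
  fix j assume j: "j \<in> J"
  have "0 \<le> lam * batch_tail b j" "0 < \<delta> * mu"
    using lam_nonneg batch_tail_nonneg \<delta> mu_pos by simp_all
  then show "B_star2 b lam mu \<delta> j j + l1_norm (J - {j}) (\<lambda>i. B_star2 b lam mu \<delta> i j) \<le> - (1 - \<delta>) * mu"
    unfolding l1_norm_def infsumI[OF B_star2_column[OF \<delta> j]] B_star2_diag[OF \<delta> j]
    by (auto simp: algebra_simps)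
qed

lemma cols_bounded_B_star2:
  assumes \<delta>: "0 < \<delta>"
  shows "cols_bounded J J (B_star2 b lam mu \<delta>) (mu + lam + mu * \<delta>)"
proof (rule cols_boundedI[OF B_star2_column[OF \<delta>]])
  fix j assume j: "j \<in> J"
  have "0 \<le> lam * batch_tail b j" "lam * batch_tail b j \<le> lam" "0 \<le> mu * \<delta>"
    using lam_nonneg mu_pos \<delta> batch_tail_nonneg batch_tail_le_1 by (auto simp: mult_left_le)
  then show "\<bar>B_star2 b lam mu \<delta> j j\<bar> + (if j = 1 then 0 else mu * \<delta>) \<le> mu + lam + mu * \<delta>"
    unfolding B_star2_diag[OF \<delta> j] using mu_pos by (auto simp: abs_if)
qed (use lam_nonneg mu_pos \<delta> in auto)

section \<open>Transfer of the decay from \<open>w\<close> to differences of solutions\<close>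

text \<open>With \<open>z\<close> the consecutive differences of the tails and
  \<open>pmf b i\<close> written as the difference of two batch tails, the Kolmogorov equation at
  \<open>i\<close> is the tail equation at \<open>i\<close> minus the one at \<open>Suc i\<close>.
  At \<open>i = 0\<close> the batch tail at 1 equals 1, matching the diagonal entry
  \<open>- lam\<close>.\<close>

lemma intertwine:
  assumes \<delta>: "0 < \<delta>" and i: "i \<in> I"
  shows "mat_vec I A (mat_vec J (DT_inv_mat \<delta>) w) i
    = mat_vec J (DT_inv_mat \<delta>) (mat_vec J (B_star2 b lam mu \<delta>) w) i"
proof -
  let ?e = "tails b \<delta> w"
  let ?z = "\<lambda>i. ?e i - ?e (Suc i)"
  \<comment> \<open>As the tail at 0 is 0, the partial sum in the arrival term telescopes: the
    nonlocal part of the Kolmogorov matrix becomes local.\<close>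
  have tel: "(\<Sum>j<i. ?z j) = - ?e i"
    using sum_lessThan_telescope[of ?e i] tails_0[of b \<delta> w]
    by (simp add: sum_subtractf algebra_simps)
  have out: "?z (Suc i) = 0" if "Suc i \<notin> I"
    using that not_in_state_space_le[of "Suc i" b "Suc (Suc i)"] by (simp add: tails_outside)
  have "mat_vec I A (mat_vec J (DT_inv_mat \<delta>) w) i = mat_vec I A ?z i"
    by (simp add: DT_inv_apply[abs_def])
  also have "\<dots> = lam * pmf b i * (- ?e i) + mu * ?z (Suc i)
    - (if i = 0 then lam else mu + lam * batch_tail b (Suc i)) * ?z i"
    unfolding tel[symmetric] by (rule kolmogorov_mat_apply[where z = ?z, OF i out])
  also have "\<dots> = mat_vec J (DT_inv_mat \<delta>) (mat_vec J (B_star2 b lam mu \<delta>) w) i"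
  proof (cases "i = 0")
    case True
    then show ?thesis
      unfolding DT_inv_apply using tails_B_star2[OF \<delta>, of "Suc 0" b lam mu w]
      by (simp add: tails_0 batch_tail_1 algebra_simps)
  next
    case False
    then show ?thesis
      unfolding DT_inv_apply using batch_tail_rec[of b i] tails_B_star2[OF \<delta>, of i b lam mu w]
        tails_B_star2[OF \<delta>, of "Suc i" b lam mu w]
      by (simp add: algebra_simps)
  qed
  finally show ?thesis .
qed

lemma weighted_decay:
  assumes \<delta>: "0 < \<delta>" and w0: "w0 \<in> l1 J"
  shows "solution_satisfies J (B_star2 b lam mu \<delta>) w0
    (\<lambda>w. \<forall>t\<ge>0. l1_norm J (w t) \<le> exp (- (1 - \<delta>) * mu * t) * l1_norm J w0)"
  unfolding solution_satisfies_def
proof (intro conjI allI impI)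
  show "\<exists>w. l1_solution J (B_star2 b lam mu \<delta>) w \<and> (\<forall>i\<in>J. w 0 i = w0 i)"
    by (rule l1_solution_exists[OF cols_bounded_B_star2[OF \<delta>] w0])
  fix w and t :: real
  assume w: "l1_solution J (B_star2 b lam mu \<delta>) w \<and> (\<forall>i\<in>J. w 0 i = w0 i)" and t: "0 \<le> t"
  then have "l1_norm J (w 0) = l1_norm J w0" by (intro l1_norm_cong) simp
  then show "l1_norm J (w t) \<le> exp (- (1 - \<delta>) * mu * t) * l1_norm J w0"
    using l1_solution_norm_le[OF cols_bounded_B_star2[OF \<delta>] log_norm_B_star2[OF \<delta>] conjunct1[OF w] t]
    by simp
qed

lemma T_apply: "mat_vec J T_mat x i = (\<Sum>\<^sub>\<infinity>j\<in>{j\<in>J. i \<le> j}. x j)"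
  unfolding mat_vec_def T_mat_def by (rule infsum_cong_neutral) auto

text \<open>At positive states, consecutive tail sums differ by the coordinate itself. At state 0,
  total mass 0 makes the deleted coordinate minus the sum of all others.\<close>

lemma DT_inv_DT:
  assumes \<delta>: "0 < \<delta>" and x: "x \<in> l1 I" and mass: "infsum x I = 0" and i: "i \<in> I"
    and w: "\<And>i. i \<in> J \<Longrightarrow> w i = mat_vec J (D_mat \<delta>) (mat_vec J T_mat x) i"
  shows "mat_vec J (DT_inv_mat \<delta>) w i = x i"
proof -
  let ?t = "\<lambda>i. \<Sum>\<^sub>\<infinity>j\<in>{j\<in>J. i \<le> j}. x j"
  have sum: "x summable_on X" if "X \<subseteq> I" for X
    using x that unfolding l1_iff by (rule summable_on_subset_banach)
  have tails: "tails b \<delta> w i = ?t i" if "0 < i" for i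
  proof (cases "i \<in> J")
    case True
    then show ?thesis
      using weight_pos[OF \<delta>, of i] by (simp add: tails_def w D_mat_def mat_vec_diag T_apply)
  next
    case False
    then have "i \<notin> I" using that by (simp add: pos_states_iff)
    then have "{j\<in>J. i \<le> j} = {}" using not_in_state_space_le by (auto simp: pos_states_iff)
    then have "?t i = 0" by (simp only: infsum_empty)
    with False show ?thesis by (simp add: tails_def)
  qed
  show ?thesis
  proof (cases "i = 0")
    case True
    have "{j\<in>J. Suc 0 \<le> j} = J" by (auto simp: pos_states_iff)
    moreover have "infsum x I = x 0 + infsum x J"
      unfolding state_space_insert using sum[of J] pos_states_iff[of _ b]
      by (subst infsum_insert) auto
    ultimately show ?thesis using True mass tails[of "Suc 0"] by (simp add: DT_inv_apply tails_0)
  next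
    case False
    then have "{j\<in>J. i \<le> j} = insert i {j\<in>J. Suc i \<le> j}" using i by (auto simp: pos_states_iff)
    then have "?t i = x i + ?t (Suc i)"
      using sum[of "{j\<in>J. Suc i \<le> j}"] by (simp add: infsum_insert pos_states_iff subset_iff)
    then show ?thesis using False tails[of i] tails[of "Suc i"] by (simp add: DT_inv_apply)
  qed
qed

text \<open>The image of \<open>w\<close> under the left inverse solves the Kolmogorov system with
  the same initial value as \<open>x\<close>, so uniqueness makes it equal to \<open>x\<close>. Both
  norm bounds are then column bounds for the left inverse, without and with row weights.\<close>

lemma solution_decay:
  assumes \<delta>: "0 < \<delta>" "\<delta> < 1" and x: "l1_solution I A x" and mass: "infsum (x 0) I = 0"
    and w0: "mat_vec J (D_mat \<delta>) (mat_vec J T_mat (x 0)) \<in> l1 J" (is "?w0 \<in> _")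
    and t: "0 \<le> t"
  shows "l1_norm I (x t) \<le> 2 * (exp (- (1 - \<delta>) * mu * t) * l1_norm J ?w0)"
    and "(\<lambda>n. real n * x t n) \<in> l1 I"
    and "l1_norm I (\<lambda>n. real n * x t n) \<le> 2 / W_const \<delta> * (exp (- (1 - \<delta>) * mu * t) * l1_norm J ?w0)"
proof -
  let ?S = "DT_inv_mat \<delta>"
  note M = cols_bounded_B_star2[OF \<delta>(1)] and S = DT_inv_cols_bounded[OF \<delta>, of b]
  obtain w where w: "l1_solution J (B_star2 b lam mu \<delta>) w" and w_init: "\<And>i. i \<in> J \<Longrightarrow> w 0 i = ?w0 i"
    using l1_solution_exists[OF M w0] by blast
  have wt: "l1_norm J (w t) \<le> exp (- (1 - \<delta>) * mu * t) * l1_norm J ?w0"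
    using weighted_decay[OF \<delta>(1) w0] w w_init t unfolding solution_satisfies_def by blast
  note wt_l1 = l1_solutionD(1)[OF w t]
  have sol: "l1_solution I A (\<lambda>t. mat_vec J ?S (w t))"
    by (rule l1_solution_image[OF M cols_bounded_kolmogorov S(1) w intertwine[OF \<delta>(1)]])
  have "x 0 i = mat_vec J ?S (w 0) i" if "i \<in> I" for i
    using DT_inv_DT[OF \<delta>(1) l1_solutionD(1)[OF x order_refl] mass that w_init] by simp
  then have rep: "x t i = mat_vec J ?S (w t) i" if "i \<in> I" for i
    using l1_solution_unique[OF cols_bounded_kolmogorov x sol _ t that] by blast
  have "l1_norm I (x t) = l1_norm I (mat_vec J ?S (w t))"
    using rep by (rule l1_norm_cong)
  also have "\<dots> \<le> 2 * l1_norm J (w t)"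
    by (rule mat_vec_l1(2)[OF S(1) wt_l1])
  also have "\<dots> \<le> 2 * (exp (- (1 - \<delta>) * mu * t) * l1_norm J ?w0)"
    using wt by simp
  finally show "l1_norm I (x t) \<le> 2 * (exp (- (1 - \<delta>) * mu * t) * l1_norm J ?w0)" .
  \<comment> \<open>The factor \<open>i\<close> is moved into the rows of the matrix, so the
    weighted vector is again a bounded image of \<open>w t\<close>.\<close>
  have "real i * x t i = mat_vec J (\<lambda>i j. real i * ?S i j) (w t) i" if "i \<in> I" for i
    unfolding rep[OF that] mat_vec_scale_row ..
  note wrep = this
  show "(\<lambda>n. real n * x t n) \<in> l1 I"
    by (rule l1_cong[THEN iffD2, OF wrep mat_vec_l1(1)[OF S(2) wt_l1]])
  have "l1_norm I (\<lambda>n. real n * x t n) = l1_norm I (mat_vec J (\<lambda>i j. real i * ?S i j) (w t))"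
    using wrep by (rule l1_norm_cong)
  also have "\<dots> \<le> 2 / W_const \<delta> * l1_norm J (w t)"
    by (rule mat_vec_l1(2)[OF S(2) wt_l1])
  also have "\<dots> \<le> 2 / W_const \<delta> * (exp (- (1 - \<delta>) * mu * t) * l1_norm J ?w0)"
    using wt W_const_pos[OF \<delta>] by (intro mult_left_mono) auto
  finally show "l1_norm I (\<lambda>n. real n * x t n)
    \<le> 2 / W_const \<delta> * (exp (- (1 - \<delta>) * mu * t) * l1_norm J ?w0)" .
qed

text \<open>The tail sum from \<open>i\<close> on is at most \<open>c / (1 - q) * q ^ i\<close>, the
  weight at most \<open>(1 / \<delta>) ^ i\<close>; their product is summable because
  \<open>q < \<delta>\<close>.\<close>

lemma geometric_imp_DT_l1:
  assumes q: "0 < q" "q < \<delta>" and \<delta>: "\<delta> < 1" and x: "\<And>i. i \<in> I \<Longrightarrow> \<bar>x i\<bar> \<le> c * q ^ i"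
  shows "mat_vec J (D_mat \<delta>) (mat_vec J T_mat x) \<in> l1 J"
proof -
  have q1: "q < 1" using q \<delta> by simp
  have \<delta>0: "0 < \<delta>" using q by simp
  have "\<bar>mat_vec J (D_mat \<delta>) (mat_vec J T_mat x) i\<bar> \<le> (c / (1 - q)) * ((1 / \<delta>) ^ i * q ^ i)"
    if i: "i \<in> J" for i
  proof -
    let ?X = "{j\<in>J. i \<le> j}"
    have b: "\<bar>x j\<bar> \<le> c * q ^ j" if "j \<in> J" for j using x that by (simp add: pos_states_iff)
    have c: "0 \<le> c * q ^ j" if "j \<in> J" for j using b[OF that] by linarith
    \<comment> \<open>The sign of \<open>c\<close> is not assumed; it follows from the bound at
      state 1, which always belongs to the state space.\<close>
    have c0: "0 \<le> c" using c[OF one_in_pos_states] q by (simp add: zero_le_mult_iff)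
    have geo: "((\<lambda>j. c * q ^ j) has_sum c * (q ^ i / (1 - q))) {i..}"
      using geometric_has_sum[of q i] q q1 by (intro has_sum_cmult_right) auto
    have sub: "?X \<subseteq> {i..}" by auto
    note s = summable_on_subset_banach[OF has_sum_imp_summable[OF geo] sub]
    have a: "(\<lambda>j. \<bar>x j\<bar>) summable_on ?X"
      by (rule summable_on_comparison_test[OF s]) (use b in auto)
    have "\<bar>mat_vec J T_mat x i\<bar> \<le> (\<Sum>\<^sub>\<infinity>j\<in>?X. \<bar>x j\<bar>)"
      unfolding T_apply using norm_infsum_bound[of x ?X] a by simp
    also have "\<dots> \<le> (\<Sum>\<^sub>\<infinity>j\<in>?X. c * q ^ j)"
      by (rule infsum_mono[OF a s]) (use b in auto)
    also have "\<dots> \<le> c * (q ^ i / (1 - q))"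
      by (rule has_sum_mono2[OF has_sum_infsum[OF s] geo sub]) (use c0 q in auto)
    finally have "weight \<delta> i * \<bar>mat_vec J T_mat x i\<bar> \<le> (1 / \<delta>) ^ i * (c * (q ^ i / (1 - q)))"
      using weight_le_power[OF \<delta>0 \<delta>, of i] weight_pos[OF \<delta>0, of i] \<delta>0 by (intro mult_mono) auto
    then show ?thesis
      using i weight_pos[OF \<delta>0, of i] by (simp add: D_mat_def mat_vec_diag abs_mult mult_ac)
  qed
  then show ?thesis by (rule l1_comparison[OF power_ratio_summable[OF q]])
qed

end

section \<open>Geometrically decaying batch sizes\<close>

locale geometric_queue = queue +
  fixes q C :: real
  assumes q: "0 < q" "q < 1" and tail: "\<And>k. 1 \<le> k \<Longrightarrow> pmf b k \<le> C * q ^ k"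
begin

lemma C_nonneg: "0 \<le> C"
proof -
  have "0 \<le> C * q" using order_trans[OF pmf_nonneg tail[of 1]] by simp
  then show ?thesis using q by (simp add: zero_le_mult_iff)
qed

lemma batch_tail_le: "1 \<le> k \<Longrightarrow> batch_tail b k \<le> C / (1 - q) * q ^ k"
  using has_sum_mono[OF batch_tail_has_sum has_sum_cmult_right[OF geometric_has_sum[of q k], of C]]
    tail q by simp

section \<open>The stationary distribution\<close>

definition rho :: real where "rho = lam / mu"

text \<open>The stationary distribution function up to normalisation:
  \<open>growth n / growth_lim\<close> is the stationary probability of fewer than \<open>n\<close>
  customers, for \<open>n \<ge> 1\<close>.\<close>

definition growth :: "nat \<Rightarrow> real" where
  "growth n = (\<Prod>k\<in>{1..<n}. 1 + rho * batch_tail b k)"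

lemma rho_nonneg: "0 \<le> rho"
  using lam_nonneg mu_pos by (simp add: rho_def)

lemma growth_Suc: "1 \<le> n \<Longrightarrow> growth (Suc n) = growth n * (1 + rho * batch_tail b n)"
  by (simp add: growth_def prod.atLeastLessThan_Suc)

lemma growth_1 [simp]: "growth 0 = 1" "growth (Suc 0) = 1"
  by (simp_all add: growth_def)

lemma growth_factor_ge_1: "1 \<le> 1 + rho * batch_tail b k"
  using rho_nonneg batch_tail_nonneg by simp

lemma growth_ge_1: "1 \<le> growth n"
  unfolding growth_def using growth_factor_ge_1 by (rule prod_ge_1)

lemma incseq_growth: "incseq growth"
proof (rule incseq_SucI)
  fix n show "growth n \<le> growth (Suc n)"
  proof (cases "1 \<le> n")
    case True
    have "growth n * 1 \<le> growth n * (1 + rho * batch_tail b n)"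
      using growth_factor_ge_1 growth_ge_1[of n] by (intro mult_left_mono) auto
    with True show ?thesis by (simp add: growth_Suc)
  qed (simp add: not_le)
qed

text \<open>From \<open>1 + x \<le> exp x\<close> and the geometric decay of the batch tails; a
  bound uniform in \<open>n\<close> is what makes the normalisation by the limit possible.\<close>

lemma growth_le: "growth n \<le> exp (rho * (C / (1 - q)) * (1 / (1 - q)))"
proof -
  have "growth n \<le> (\<Prod>k\<in>{1..<n}. exp (rho * batch_tail b k))"
    unfolding growth_def
    using exp_ge_add_one_self order_trans[OF zero_le_one growth_factor_ge_1] by (intro prod_mono) auto
  also have "\<dots> = exp (\<Sum>k\<in>{1..<n}. rho * batch_tail b k)" by (simp add: exp_sum)
  also have "\<dots> \<le> exp (\<Sum>k\<in>{1..<n}. rho * (C / (1 - q)) * q ^ k)"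
    unfolding exp_le_cancel_iff mult.assoc[of rho]
    by (intro sum_mono mult_left_mono batch_tail_le rho_nonneg) auto
  also have "(\<Sum>k\<in>{1..<n}. rho * (C / (1 - q)) * q ^ k) = rho * (C / (1 - q)) * (\<Sum>k\<in>{1..<n}. q ^ k)"
    by (rule sum_distrib_left[symmetric])
  also have "\<dots> \<le> rho * (C / (1 - q)) * (1 / (1 - q))"
  proof (rule mult_left_mono)
    show "(\<Sum>k\<in>{1..<n}. q ^ k) \<le> 1 / (1 - q)"
      using finite_sum_le_has_sum[OF geometric_has_sum[of q 0], of "{1..<n}"] q by auto
    show "0 \<le> rho * (C / (1 - q))" using rho_nonneg C_nonneg q by simp
  qed
  finally show ?thesis by simp
qed

definition growth_lim :: real where "growth_lim = lim growth"

lemma growth_lim: "growth \<longlonglongrightarrow> growth_lim" "growth n \<le> growth_lim" "1 \<le> growth_lim"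
proof -
  have "convergent growth"
    using incseq_convergent[OF incseq_growth] growth_le by (metis convergentI)
  then show lim: "growth \<longlonglongrightarrow> growth_lim" by (simp add: growth_lim_def convergent_LIMSEQ_iff)
  show le: "growth n \<le> growth_lim" for n by (rule incseq_le[OF incseq_growth lim])
  show "1 \<le> growth_lim" using order_trans[OF growth_ge_1 le] .
qed

text \<open>
  The tails \<open>y\<^sub>i = P(X \<ge> i)\<close> of a stationary distribution satisfy
  \<open>(\<mu> + \<lambda> B\<^sub>i) y\<^sub>i = \<mu> y\<^sub>i\<^sub>+\<^sub>1 + \<lambda> B\<^sub>i\<close>, so \<open>F\<^sub>i = 1 - y\<^sub>i\<close> obeys \<open>F\<^sub>i\<^sub>+\<^sub>1 = (1 + \<lambda> B\<^sub>i / \<mu>) F\<^sub>i\<close>.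
\<close>

definition stationary :: "nat \<Rightarrow> real" where
  "stationary i = (if i = 0 then 1 else rho * batch_tail b i * growth i) / growth_lim"

lemma stationary_nonneg: "0 \<le> stationary i"
  using growth_lim(3) growth_ge_1[of i] rho_nonneg batch_tail_nonneg[of b i]
  by (simp add: stationary_def)

lemma stationary_outside: "i \<notin> I \<Longrightarrow> stationary i = 0"
  using batch_tail_outside_state_space[of i b] zero_in_state_space[of b] by (auto simp: stationary_def)

text \<open>Telescoping: \<open>rho * batch_tail b n * growth n\<close> is the increment of
  \<open>growth\<close> from \<open>n\<close> to \<open>Suc n\<close>.\<close>

lemma sum_stationary: "(\<Sum>j<Suc n. stationary j) = growth (Suc n) / growth_lim"
proof (induction n)
  case (Suc n)
  then show ?case
    by (simp add: growth_Suc[of "Suc n"] stationary_def[of "Suc n"] add_divide_distrib[symmetric])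
      (simp add: algebra_simps)
qed (simp add: stationary_def)

lemma stationary_has_sum: "(stationary has_sum 1) I"
proof -
  have "(\<lambda>n. growth n / growth_lim) \<longlonglongrightarrow> growth_lim / growth_lim"
    using growth_lim by (intro tendsto_intros) auto
  then have "(\<lambda>n. \<Sum>j<Suc n. stationary j) \<longlonglongrightarrow> 1"
    unfolding sum_stationary using growth_lim(3) LIMSEQ_Suc by force
  then have "stationary sums 1" unfolding sums_def by (rule LIMSEQ_imp_Suc)
  then have "(stationary has_sum 1) UNIV" by (rule sums_nonneg_imp_has_sum) (rule stationary_nonneg)
  moreover have "(stationary has_sum 1) I = (stationary has_sum 1) UNIV"
    by (rule has_sum_cong_neutral) (auto simp: stationary_outside)
  ultimately show ?thesis by simp
qed

lemma prob_vector_stationary: "prob_vector I stationary"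
  unfolding prob_vector_def using stationary_nonneg stationary_has_sum by simp

text \<open>After clearing \<open>growth_lim\<close>, writing \<open>pmf b i\<close> as a difference
  of batch tails and expanding \<open>growth (Suc i)\<close>, the whole expression is a multiple of
  \<open>lam - mu * rho\<close>, which is 0.\<close>

lemma kolmogorov_stationary:
  assumes i: "i \<in> I" shows "mat_vec I A stationary i = 0"
proof -
  have eq: "mat_vec I A stationary i = lam * pmf b i * (\<Sum>j<i. stationary j) + mu * stationary (Suc i)
      - (if i = 0 then lam else mu + lam * batch_tail b (Suc i)) * stationary i"
    by (rule kolmogorov_mat_apply[OF i stationary_outside])
  have lam: "lam - mu * rho = 0" using mu_pos by (simp add: rho_def)
  show ?thesis
  proof (cases i)
    case 0
    then have "mat_vec I A stationary i * growth_lim = - (lam - mu * rho)"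
      unfolding eq using growth_lim(3) by (simp add: pmf_0 stationary_def batch_tail_1 field_simps)
    then show ?thesis using lam growth_lim(3) by simp
  next
    case (Suc n)
    have s: "(\<Sum>j<i. stationary j) = growth i / growth_lim" unfolding Suc by (rule sum_stationary)
    have p: "pmf b i = batch_tail b i - batch_tail b (Suc i)" using batch_tail_rec[of b i] by simp
    have "mat_vec I A stationary i * growth_lim
      = lam * pmf b i * growth i + mu * (rho * batch_tail b (Suc i) * growth (Suc i))
        - (mu + lam * batch_tail b (Suc i)) * (rho * batch_tail b i * growth i)"
      unfolding eq s using growth_lim(3) Suc by (simp add: stationary_def field_simps)
    also have "\<dots> = (lam - mu * rho) * (batch_tail b i - batch_tail b (Suc i)
        - batch_tail b (Suc i) * rho * batch_tail b i) * growth i"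
      unfolding p using growth_Suc[of i] Suc by (simp add: algebra_simps)
    finally show ?thesis using lam growth_lim(3) by simp
  qed
qed

text \<open>Dividing by \<open>growth_lim\<close> absorbs the product, so the decay is that of the
  batch tails; the summand 1 in the constant covers \<open>i = 0\<close>.\<close>

lemma stationary_le: "\<bar>stationary i\<bar> \<le> (1 + rho * (C / (1 - q))) * q ^ i"
proof (cases "i = 0")
  case True
  have "0 \<le> rho * (C / (1 - q))" using rho_nonneg C_nonneg q by simp
  moreover have "1 / growth_lim \<le> 1" using growth_lim(3) by simp
  moreover have "\<bar>stationary i\<bar> = 1 / growth_lim"
    using True growth_lim(3) by (simp add: stationary_def)
  ultimately show ?thesis unfolding True power_0 mult_1_right by linarith
next
  case False
  have "growth i / growth_lim \<le> 1" using growth_lim(2)[of i] growth_lim(3) by simp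
  then have "rho * batch_tail b i * (growth i / growth_lim) \<le> rho * batch_tail b i"
    using rho_nonneg batch_tail_nonneg[of b i] by (intro mult_left_le) auto
  also have "\<dots> \<le> rho * (C / (1 - q) * q ^ i)"
    using batch_tail_le[of i] False rho_nonneg by (intro mult_left_mono) auto
  also have "\<dots> \<le> (1 + rho * (C / (1 - q))) * q ^ i" using q by (simp add: distrib_right mult.assoc)
  finally show ?thesis using False stationary_nonneg[of i] by (simp add: stationary_def)
qed

lemma stationary_l1: "stationary \<in> l1 I"
  using stationary_le by (rule geometric_imp_l1[OF q])

lemma stationary_solution: "l1_solution I A (\<lambda>t. stationary)"
  by (rule l1_solution_const[OF stationary_l1 kolmogorov_stationary])

section \<open>Convergence to the stationary solution, and the mean\<close>

text \<open>Puts unit masses and truncated vectors on the same footing as the stationary vector, so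
  that one geometric bound covers their difference.\<close>

lemma finite_support_geometric:
  assumes "\<And>i. n < i \<Longrightarrow> x i = 0"
  shows "\<bar>x i\<bar> \<le> (\<Sum>k\<le>n. \<bar>x k\<bar> / q ^ k) * q ^ i"
proof (cases "i \<le> n")
  case True
  have "\<bar>x i\<bar> / q ^ i \<le> (\<Sum>k\<le>n. \<bar>x k\<bar> / q ^ k)"
    using True q by (intro member_le_sum) auto
  then show ?thesis using q by (simp add: pos_divide_le_eq)
next
  case False
  then show ?thesis using assms[of i] q by (simp add: sum_nonneg)
qed

text \<open>One comparison vector has finite weighted distance for all \<open>\<delta>\<close>
  between \<open>q\<close> and 1 at once.\<close>

lemma w_vec_stationary_l1:
  assumes "q < \<delta>" "\<delta> < 1" and "\<And>i. n < i \<Longrightarrow> x i = 0"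
  shows "w_vec b \<delta> x stationary \<in> l1 J"
proof -
  have "\<bar>x i - stationary i\<bar>
    \<le> ((\<Sum>k\<le>n. \<bar>x k\<bar> / q ^ k) + (1 + rho * (C / (1 - q)))) * q ^ i" for i
    using finite_support_geometric[of n x i, OF assms(3)] stationary_le[of i] by (simp add: distrib_right)
  from geometric_imp_DT_l1[OF q(1) assms(1,2) this] show ?thesis by (simp add: w_vec_def)
qed

lemma prob_vector_l1: "prob_vector I x \<Longrightarrow> x \<in> l1 I"
  by (auto simp: prob_vector_def l1_iff dest: has_sum_imp_summable)

lemma difference_decay:
  assumes \<delta>: "q < \<delta>" "\<delta> < 1"
    and p1: "l1_solution I A p1" "(p1 0 has_sum 1) I" and p2: "l1_solution I A p2" "(p2 0 has_sum 1) I"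
    and w0: "w_vec b \<delta> (p1 0) (p2 0) \<in> l1 J" and t: "0 \<le> t"
  defines "E \<equiv> exp (- (1 - \<delta>) * mu * t) * l1_norm J (w_vec b \<delta> (p1 0) (p2 0))"
  shows "l1_norm I (\<lambda>i. p1 t i - p2 t i) \<le> 2 * E"
    and "(\<lambda>n. real n * (p1 t n - p2 t n)) \<in> l1 I"
    and "l1_norm I (\<lambda>n. real n * (p1 t n - p2 t n)) \<le> 2 / W_const \<delta> * E"
proof -
  have \<delta>0: "0 < \<delta>" using \<delta> q by simp
  have mass: "(\<Sum>\<^sub>\<infinity>i\<in>I. p1 0 i - p2 0 i) = 0"
    using infsumI[OF has_sum_minus[OF p1(2) p2(2)]] by simp
  note d = solution_decay[OF \<delta>0 \<delta>(2) l1_solution_diff[OF cols_bounded_kolmogorov p1(1) p2(1)]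
      mass w0[unfolded w_vec_def] t]
  show "l1_norm I (\<lambda>i. p1 t i - p2 t i) \<le> 2 * E"
    "(\<lambda>n. real n * (p1 t n - p2 t n)) \<in> l1 I"
    "l1_norm I (\<lambda>n. real n * (p1 t n - p2 t n)) \<le> 2 / W_const \<delta> * E"
    using d unfolding E_def w_vec_def by auto
qed

lemma exp_decay: "\<delta> < 1 \<Longrightarrow> ((\<lambda>t. c * (exp (- (1 - \<delta>) * mu * t) * d)) \<longlongrightarrow> 0) at_top" for \<delta> c d :: real
proof -
  assume "\<delta> < 1"
  then have "filterlim (\<lambda>t. (- (1 - \<delta>) * mu) * t) at_bot at_top"
    using mu_pos by (intro filterlim_tendsto_neg_mult_at_bot[OF tendsto_const _ filterlim_ident])
      (simp add: mult_less_0_iff)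
  then have "((\<lambda>t. exp ((- (1 - \<delta>) * mu) * t)) \<longlongrightarrow> 0) at_top"
    by (rule filterlim_compose[OF exp_at_bot])
  from tendsto_mult[OF tendsto_const[of c] tendsto_mult[OF this tendsto_const[of d]]]
  show ?thesis by simp
qed

text \<open>
  Initial vectors with infinite weighted norm are approximated in \<open>l1\<close> by finitely supported ones,
  the system being an \<open>l1\<close>-contraction.
\<close>

lemma converges_to_stationary:
  assumes p: "l1_solution I A p" and p0: "prob_vector I (p 0)"
  shows "((\<lambda>t. l1_norm I (\<lambda>i. p t i - stationary i)) \<longlongrightarrow> 0) at_top"
proof (rule order_tendstoI)
  fix e :: real assume "0 < e"
  then have e: "0 < e / 4" by simp
  obtain \<delta> where \<delta>: "q < \<delta>" "\<delta> < 1" using dense[OF q(2)] by blast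
  have nonneg: "0 \<le> p 0 i" if "i \<in> I" for i using p0 that by (simp add: prob_vector_def)
  have total: "(p 0 has_sum 1) I" using p0 by (simp add: prob_vector_def)
  obtain F where F: "finite F" "F \<subseteq> I" "dist (sum (p 0) F) 1 \<le> e / 4"
    using has_sum_finite_approximation[OF total e] by blast
  define r where "r = 1 - sum (p 0) F"
  have r: "0 \<le> r" "r \<le> e / 4"
    using F finite_sum_le_has_sum[OF total F(1,2)] nonneg by (auto simp: r_def dist_real_def)
  \<comment> \<open>A truncation to \<open>F\<close> whose missing mass \<open>r\<close> is moved to
    state 0: the total stays 1, as \<open>difference_decay\<close> requires, at a cost of at most
    \<open>2 * r\<close> in norm.\<close>
  define x where "x i = (if i \<in> F then p 0 i else 0) + (if i = 0 then r else 0)" for i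
  have sumF: "((\<lambda>i. if i \<in> F then p 0 i else 0) has_sum sum (p 0) F) I"
    by (rule has_sum_finite_neutralI[OF F(1,2)]) auto
  have sum0: "((\<lambda>i. if i = 0 then r else 0) has_sum r) I"
    by (rule has_sum_finite_neutralI[of "{0}"]) auto
  have x_sum: "(x has_sum 1) I"
    using has_sum_add[OF sumF sum0] by (simp add: x_def[abs_def] r_def)
  have x_l1: "x \<in> l1 I" using x_sum by (simp add: l1_iff has_sum_imp_summable)
  have x_support: "x i = 0" if "Max (insert 0 F) < i" for i
    using that F(1) Max_ge[of "insert 0 F" i] by (auto simp: x_def)
  have "((\<lambda>i. \<bar>p 0 i - (if i \<in> F then p 0 i else 0)\<bar>) has_sum r) I"
    using has_sum_minus[OF total sumF] unfolding r_def
    by (rule has_sum_cong[THEN iffD1, rotated]) (use nonneg in auto)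
  then have near1: "(\<lambda>i. p 0 i - (if i \<in> F then p 0 i else 0)) \<in> l1 I"
      "l1_norm I (\<lambda>i. p 0 i - (if i \<in> F then p 0 i else 0)) = r"
    by (auto simp: l1_def l1_norm_def has_sum_iff)
  have "((\<lambda>i. \<bar>if i = 0 then r else 0\<bar>) has_sum r) I"
    using sum0 by (rule has_sum_cong[THEN iffD1, rotated]) (use r in auto)
  then have near2: "(\<lambda>i. if i = 0 then r else 0) \<in> l1 I" "l1_norm I (\<lambda>i. if i = 0 then r else 0) = r"
    by (auto simp: l1_def l1_norm_def has_sum_iff)
  have near: "l1_norm I (\<lambda>i. p 0 i - x i) \<le> 2 * r"
    using l1_norm_triangle_diff[OF near1(1) near2(1)] near1(2) near2(2)
    by (simp add: x_def diff_diff_eq)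
  obtain y where y: "l1_solution I A y" and y0: "\<And>i. i \<in> I \<Longrightarrow> y 0 i = x i"
    using l1_solution_exists[OF cols_bounded_kolmogorov x_l1] by blast
  have y_sum: "(y 0 has_sum 1) I" using x_sum y0 by (simp cong: has_sum_cong)
  have w0: "w_vec b \<delta> (y 0) stationary \<in> l1 J"
  proof -
    have "w_vec b \<delta> (y 0) stationary = w_vec b \<delta> x stationary"
      unfolding w_vec_def using y0 by (intro arg_cong[where f = "mat_vec J (D_mat \<delta>)"] mat_vec_cong)
        (simp add: pos_states_iff)
    then show ?thesis using w_vec_stationary_l1[OF \<delta> x_support] by simp
  qed
  let ?E = "\<lambda>t. 2 * (exp (- (1 - \<delta>) * mu * t) * l1_norm J (w_vec b \<delta> (y 0) stationary))"
  have "eventually (\<lambda>t. ?E t < e / 4) at_top"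
    using exp_decay[OF \<delta>(2)] e by (rule order_tendstoD)
  then show "eventually (\<lambda>t. l1_norm I (\<lambda>i. p t i - stationary i) < e) at_top"
    using eventually_ge_at_top[of 0]
  proof eventually_elim
    case (elim t)
    note pt = l1_solutionD(1)[OF p elim(2)] and yt = l1_solutionD(1)[OF y elim(2)]
    have "l1_norm I (\<lambda>i. p t i - y t i) \<le> l1_norm I (\<lambda>i. p 0 i - y 0 i)"
      using l1_solution_norm_le[OF cols_bounded_kolmogorov log_norm_kolmogorov
          l1_solution_diff[OF cols_bounded_kolmogorov p y] elim(2)] by simp
    also have "\<dots> = l1_norm I (\<lambda>i. p 0 i - x i)" using y0 by (intro l1_norm_cong) simp
    finally have 1: "l1_norm I (\<lambda>i. p t i - y t i) \<le> 2 * r" using near by simp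
    have 2: "l1_norm I (\<lambda>i. y t i - stationary i) \<le> ?E t"
      using difference_decay(1)[OF \<delta> y y_sum stationary_solution stationary_has_sum w0 elim(2)] .
    have "l1_norm I (\<lambda>i. p t i - stationary i)
      \<le> l1_norm I (\<lambda>i. p t i - y t i) + l1_norm I (\<lambda>i. y t i - stationary i)"
      using l1_norm_triangle[OF l1_diff[OF pt yt] l1_diff[OF yt stationary_l1]] by simp
    then show ?case using 1 2 elim(1) r \<open>0 < e\<close> by linarith
  qed
qed (use order_less_le_trans[OF _ l1_norm_nonneg] in auto)

lemma strongly_ergodic: "strongly_ergodic b lam mu"
  unfolding strongly_ergodic_def
proof (intro exI[of _ stationary] conjI allI impI)
  fix p0 assume p0: "prob_vector I p0"
  have "prob_vector I (p 0)" if "\<forall>i\<in>I. p 0 i = p0 i" for p :: "real \<Rightarrow> nat \<Rightarrow> real"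
    using p0 that by (simp add: prob_vector_def cong: has_sum_cong)
  then show "solution_satisfies I A p0 (\<lambda>p. ((\<lambda>t. l1_norm I (\<lambda>i. p t i - stationary i)) \<longlongrightarrow> 0) at_top)"
    unfolding solution_satisfies_def
    using l1_solution_exists[OF cols_bounded_kolmogorov prob_vector_l1[OF p0]] converges_to_stationary
    by blast
qed (rule prob_vector_stationary)

lemma has_finite_mean_stationary: "has_finite_mean b stationary"
  using geometric_imp_finite_mean[OF q stationary_le] by (simp add: has_finite_mean_def l1_iff)

lemma unit_mass_has_sum: "k \<in> I \<Longrightarrow> (unit_mass k has_sum 1) I"
  by (rule has_sum_finite_neutralI[of "{k}"]) (auto simp: unit_mass_def)

text \<open>Finiteness of the mean of \<open>p t\<close> is not known beforehand; it follows by
  splitting \<open>n * p t n\<close> into the weighted difference, which lies in \<open>l1\<close>,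
  and the stationary part. The difference of the means is then at most the weighted norm.\<close>

lemma mean_decay:
  assumes k: "k \<in> I" and \<delta>: "q < \<delta>" "\<delta> < 1"
    and p: "l1_solution I A p" "\<forall>i\<in>I. p 0 i = unit_mass k i" and t: "0 \<le> t"
  shows "has_finite_mean b (p t)"
    and "\<bar>mean b (p t) - mean b stationary\<bar>
      \<le> 2 / W_const \<delta> * (exp (- (1 - \<delta>) * mu * t) * l1_norm J (w_vec b \<delta> (unit_mass k) stationary))"
proof -
  have p_sum: "(p 0 has_sum 1) I" using unit_mass_has_sum[OF k] p(2) by (simp cong: has_sum_cong)
  have w_eq: "w_vec b \<delta> (p 0) stationary = w_vec b \<delta> (unit_mass k) stationary"
    unfolding w_vec_def using p(2) by (intro arg_cong[where f = "mat_vec J (D_mat \<delta>)"] mat_vec_cong)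
      (simp add: pos_states_iff)
  have w0: "w_vec b \<delta> (p 0) stationary \<in> l1 J"
    unfolding w_eq by (rule w_vec_stationary_l1[OF \<delta>, of k]) (simp add: unit_mass_def)
  note d = difference_decay[OF \<delta> p(1) p_sum stationary_solution stationary_has_sum w0 t]
  let ?d = "\<lambda>n. real n * (p t n - stationary n)"
  have "((\<lambda>n. ?d n + real n * stationary n) has_sum (infsum ?d I + mean b stationary)) I"
    using d(2) has_finite_mean_stationary unfolding mean_def l1_iff has_finite_mean_def
    by (intro has_sum_add has_sum_infsum)
  then have s: "((\<lambda>n. real n * p t n) has_sum (infsum ?d I + mean b stationary)) I"
    by (simp add: algebra_simps)
  show "has_finite_mean b (p t)" unfolding has_finite_mean_def using s by (rule has_sum_imp_summable)
  have "\<bar>mean b (p t) - mean b stationary\<bar> = \<bar>infsum ?d I\<bar>"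
    using infsumI[OF s] by (simp add: mean_def)
  also have "\<dots> \<le> l1_norm I ?d"
    unfolding l1_norm_def using norm_infsum_bound[of ?d I] d(2) by (simp add: l1_def)
  also note d(3)
  finally show "\<bar>mean b (p t) - mean b stationary\<bar>
    \<le> 2 / W_const \<delta> * (exp (- (1 - \<delta>) * mu * t) * l1_norm J (w_vec b \<delta> (unit_mass k) stationary))"
    unfolding w_eq .
qed

lemma unit_mass_solution_satisfiesI:
  assumes "k \<in> I" "\<And>p. l1_solution I A p \<Longrightarrow> \<forall>i\<in>I. p 0 i = unit_mass k i \<Longrightarrow> P p"
  shows "solution_satisfies I A (unit_mass k) P"
  unfolding solution_satisfies_def
  using l1_solution_exists[OF cols_bounded_kolmogorov, of "unit_mass k"] unit_mass_has_sum[OF assms(1)]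
    assms(2) by (auto simp: l1_iff dest: has_sum_imp_summable)

lemma limiting_mean_stationary: "limiting_mean b lam mu (\<lambda>t. mean b stationary)"
  unfolding limiting_mean_def
proof (intro ballI unit_mass_solution_satisfiesI conjI allI impI)
  obtain \<delta> where \<delta>: "q < \<delta>" "\<delta> < 1" using dense[OF q(2)] by blast
  fix k p assume k: "k \<in> I" and p: "l1_solution I A p" "\<forall>i\<in>I. p 0 i = unit_mass k i"
  note d = mean_decay[OF k \<delta> p]
  show "has_finite_mean b (p t)" if "0 \<le> t" for t using d(1)[OF that] .
  show "((\<lambda>t. mean b (p t) - mean b stationary) \<longlongrightarrow> 0) at_top"
  proof (rule Lim_null_comparison[OF _ exp_decay[OF \<delta>(2)]])
    show "eventually (\<lambda>t. norm (mean b (p t) - mean b stationary)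
      \<le> 2 / W_const \<delta> * (exp (- (1 - \<delta>) * mu * t) * l1_norm J (w_vec b \<delta> (unit_mass k) stationary))) at_top"
      using eventually_ge_at_top[of 0] by eventually_elim (use d(2) in simp)
  qed
qed

end

theorem corollary2:
  fixes b :: "nat pmf" and lam mu q C :: real
  assumes batches: "0 \<notin> set_pmf b"
    and finite_mean: "integrable (measure_pmf b) real"
    and lam: "0 \<le> lam" and mu: "0 < mu"
    and q: "0 < q" "q < 1" and C: "0 < C"
    and tail: "\<And>k. 1 \<le> k \<Longrightarrow> pmf b k \<le> C * q ^ k"
  shows "strongly_ergodic b lam mu \<and>
    (\<forall>\<delta>\<in>{q<..<1}. \<forall>w0\<in>l1 (pos_states b).
       solution_satisfies (pos_states b) (B_star2 b lam mu \<delta>) w0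
         (\<lambda>w. \<forall>t\<ge>0. l1_norm (pos_states b) (w t)
                 \<le> exp (- (1 - \<delta>) * mu * t) * l1_norm (pos_states b) w0)) \<and>
    (\<forall>\<delta>\<in>{q<..<1}. \<forall>p1 p2.
       kolmogorov_solution b lam mu p1 \<and> prob_vector (state_space b) (p1 0) \<and>
       kolmogorov_solution b lam mu p2 \<and> prob_vector (state_space b) (p2 0) \<and>
       w_vec b \<delta> (p1 0) (p2 0) \<in> l1 (pos_states b) \<longrightarrow>
       (\<forall>t\<ge>0. l1_norm (state_space b) (\<lambda>i. p1 t i - p2 t i)
          \<le> 4 * exp (- (1 - \<delta>) * mu * t) *
              l1_norm (pos_states b) (w_vec b \<delta> (p1 0) (p2 0)))) \<and>
    (\<exists>\<phi> p2.
       limiting_mean b lam mu \<phi> \<and>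
       kolmogorov_solution b lam mu p2 \<and> prob_vector (state_space b) (p2 0) \<and>
       (\<forall>t\<ge>0. has_finite_mean b (p2 t) \<and> mean b (p2 t) = \<phi> t) \<and>
       (\<forall>\<delta>\<in>{q<..<1}. 0 < W_const \<delta> \<and>
         (\<forall>k\<in>state_space b.
            w_vec b \<delta> (unit_mass k) (p2 0) \<in> l1 (pos_states b) \<and>
            solution_satisfies (state_space b) (kolmogorov_mat b lam mu) (unit_mass k)
              (\<lambda>p. \<forall>t\<ge>0. \<bar>mean b (p t) - \<phi> t\<bar>
                 \<le> 4 / W_const \<delta> * exp (- (1 - \<delta>) * mu * t) *
                     l1_norm (pos_states b) (w_vec b \<delta> (unit_mass k) (p2 0))))))"
proof -
  interpret geometric_queue b lam mu q C
    using batches lam mu q tail by unfold_locales auto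
  \<comment> \<open>Relaxes the proved factor 2 to the stated 4; \<open>c\<close> is 1 for the norm
    bound and \<open>1 / W_const \<delta>\<close> for the mean.\<close>
  have rate: "c * 2 * (E * n) \<le> c * 4 * E * n" if "0 \<le> c" "0 \<le> E" "0 \<le> n" for c E n :: real
    using mult_nonneg_nonneg[OF that(1) mult_nonneg_nonneg[OF that(2,3)]] by (simp add: mult_ac)
  show ?thesis
  proof (intro conjI)
    show "strongly_ergodic b lam mu" by (rule strongly_ergodic)
    show "\<forall>\<delta>\<in>{q<..<1}. \<forall>w0\<in>l1 J. solution_satisfies J (B_star2 b lam mu \<delta>) w0
      (\<lambda>w. \<forall>t\<ge>0. l1_norm J (w t) \<le> exp (- (1 - \<delta>) * mu * t) * l1_norm J w0)"
      using q weighted_decay by simp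
    show "\<forall>\<delta>\<in>{q<..<1}. \<forall>p1 p2.
       kolmogorov_solution b lam mu p1 \<and> prob_vector I (p1 0) \<and>
       kolmogorov_solution b lam mu p2 \<and> prob_vector I (p2 0) \<and>
       w_vec b \<delta> (p1 0) (p2 0) \<in> l1 J \<longrightarrow>
       (\<forall>t\<ge>0. l1_norm I (\<lambda>i. p1 t i - p2 t i)
          \<le> 4 * exp (- (1 - \<delta>) * mu * t) * l1_norm J (w_vec b \<delta> (p1 0) (p2 0)))"
    proof (intro ballI allI impI, elim conjE)
      fix \<delta> p1 p2 and t :: real
      assume \<delta>: "\<delta> \<in> {q<..<1}" and t: "0 \<le> t"
        and p: "kolmogorov_solution b lam mu p1" "prob_vector I (p1 0)"
          "kolmogorov_solution b lam mu p2" "prob_vector I (p2 0)"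
        and w0: "w_vec b \<delta> (p1 0) (p2 0) \<in> l1 J"
      have "l1_norm I (\<lambda>i. p1 t i - p2 t i)
        \<le> 2 * (exp (- (1 - \<delta>) * mu * t) * l1_norm J (w_vec b \<delta> (p1 0) (p2 0)))"
        using difference_decay(1)[of \<delta> p1 p2 t] p \<delta> w0 t
        unfolding kolmogorov_solution_def prob_vector_def by simp
      also have "\<dots> \<le> 4 * exp (- (1 - \<delta>) * mu * t) * l1_norm J (w_vec b \<delta> (p1 0) (p2 0))"
        using rate[of 1 "exp (- (1 - \<delta>) * mu * t)" "l1_norm J (w_vec b \<delta> (p1 0) (p2 0))"]
        by (simp add: l1_norm_nonneg)
      finally show "l1_norm I (\<lambda>i. p1 t i - p2 t i)
        \<le> 4 * exp (- (1 - \<delta>) * mu * t) * l1_norm J (w_vec b \<delta> (p1 0) (p2 0))" .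
    qed
    show "\<exists>\<phi> p2. limiting_mean b lam mu \<phi> \<and>
       kolmogorov_solution b lam mu p2 \<and> prob_vector I (p2 0) \<and>
       (\<forall>t\<ge>0. has_finite_mean b (p2 t) \<and> mean b (p2 t) = \<phi> t) \<and>
       (\<forall>\<delta>\<in>{q<..<1}. 0 < W_const \<delta> \<and>
         (\<forall>k\<in>I. w_vec b \<delta> (unit_mass k) (p2 0) \<in> l1 J \<and>
            solution_satisfies I A (unit_mass k)
              (\<lambda>p. \<forall>t\<ge>0. \<bar>mean b (p t) - \<phi> t\<bar>
                 \<le> 4 / W_const \<delta> * exp (- (1 - \<delta>) * mu * t) *
                     l1_norm J (w_vec b \<delta> (unit_mass k) (p2 0)))))"
    proof (intro exI[of _ "\<lambda>t. mean b stationary"] exI[of _ "\<lambda>t. stationary"] conjI ballI allI impI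
        unit_mass_solution_satisfiesI)
      fix \<delta> assume "\<delta> \<in> {q<..<1}"
      then have \<delta>: "q < \<delta>" "\<delta> < 1" by auto
      show W: "0 < W_const \<delta>" using W_const_pos[of \<delta>] \<delta> q by simp
      fix k assume k: "k \<in> I"
      then show "k \<in> I" .
      show "w_vec b \<delta> (unit_mass k) stationary \<in> l1 J"
        by (rule w_vec_stationary_l1[OF \<delta>, of k]) (simp add: unit_mass_def)
      let ?n = "l1_norm J (w_vec b \<delta> (unit_mass k) stationary)"
      fix p and t :: real
      assume p: "l1_solution I A p" "\<forall>i\<in>I. p 0 i = unit_mass k i" and t: "0 \<le> t"
      have "\<bar>mean b (p t) - mean b stationary\<bar>
        \<le> 2 / W_const \<delta> * (exp (- (1 - \<delta>) * mu * t) * ?n)"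
        by (rule mean_decay(2)[OF k \<delta> p t])
      also have "\<dots> \<le> 4 / W_const \<delta> * exp (- (1 - \<delta>) * mu * t) * ?n"
        using rate[of "1 / W_const \<delta>" "exp (- (1 - \<delta>) * mu * t)" ?n] W by (simp add: l1_norm_nonneg)
      finally show "\<bar>mean b (p t) - mean b stationary\<bar>
        \<le> 4 / W_const \<delta> * exp (- (1 - \<delta>) * mu * t) * ?n" .
    qed (simp_all add: limiting_mean_stationary kolmogorov_solution_def stationary_solution
        prob_vector_stationary has_finite_mean_stationary)
  qed
qed

end
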